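(* Let $F:\mathbb{C}^n\to\mathbb{C}^n$ be a power series mapping with components $F_i(X_1,\dots,X_n):=X_i-\sum_{\alpha\ne0}\frac{H_{i,\alpha}}{\alpha!}X^\alpha$ converging in a neighbourhood of $0$, and suppose $\sum_{k=0}^\infty A^k$ converges, where $A_{i,j}=H_{i,\mathbf{e}_j}$. Then $F$ has an analytic inverse with $F_i^{-1}(X_1,\dots,X_n)=\sum_{\alpha\ne0}g_{i,\alpha}X^\alpha$, where $$g_{i,\alpha}:=\sum_{\mathcal{T}\in\mathbb{S}_{i,\alpha}}\ \prod_{v\text{ internal vertex of }\mathcal{T}}\frac{H_{\tau(v),\mu(v)}}{|\mu(v)|!}.$$
   Context: For $\alpha\in\mathbb{Z}^n_{\ge0}$: $\alpha!=\alpha_1!\cdots\alpha_n!$, $|\alpha|=\alpha_1+\dots+\alpha_n$, $X^\alpha=X_1^{\alpha_1}\cdots X_n^{\alpha_n}$; $\mathbf{e}_j$ is the $j$-th unit multi-index. An $n$-type tree $\mathcal{T}=(T,\tau)$ is a finite rooted planar tree (children ordered left to right, any finite number of children) with types $\tau:V\to[n]$; no constraint is imposed on the order of types among siblings. A vertex is internal if it has a child; for internal $v$, $\mu(v)\in\mathbb{Z}^n_{\ge0}$ counts its children of each type, so $|\mu(v)|$ is its number of children. $\mathbb{S}_{i,\alpha}$ is the set of such $n$-type trees with root type $i$ and exactly $\alpha_j$ leaves of type $j$ for each $j$.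
   Formalization: The infinite sum over trees defining g_{i,α} need not converge unconditionally when only ΣA^k converges (e.g. A=[[1,1],[-1,-1]]), so it is taken as the limit, proved to exist, of the sums over trees with at most N vertices as N→∞. *)

theory Defs
  imports "HOL-Analysis.Analysis"
begin

text \<open>Variables are indexed by a finite type 'n (so n = CARD('n)); multi-indices are
  functions 'n \<Rightarrow> nat; points of C^n are functions 'n \<Rightarrow> complex.\<close>

definition mfact :: "('n::finite \<Rightarrow> nat) \<Rightarrow> nat" where
  "mfact \<alpha> = (\<Prod>j\<in>UNIV. fact (\<alpha> j))"

definition monom :: "('n::finite \<Rightarrow> complex) \<Rightarrow> ('n \<Rightarrow> nat) \<Rightarrow> complex" where
  "monom z \<alpha> = (\<Prod>j\<in>UNIV. z j ^ \<alpha> j)"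

definition unitidx :: "'n \<Rightarrow> ('n \<Rightarrow> nat)" where
  "unitidx j = (\<lambda>k. if k = j then 1 else 0)"

definition ps_conv :: "(('n::finite \<Rightarrow> nat) \<Rightarrow> complex) \<Rightarrow> ('n \<Rightarrow> complex) \<Rightarrow> bool" where
  "ps_conv c z \<longleftrightarrow> (\<lambda>\<alpha>. c \<alpha> * monom z \<alpha>) summable_on UNIV"

definition ps_eval :: "(('n::finite \<Rightarrow> nat) \<Rightarrow> complex) \<Rightarrow> ('n \<Rightarrow> complex) \<Rightarrow> complex" where
  "ps_eval c z = (\<Sum>\<^sub>\<infinity>\<alpha>. c \<alpha> * monom z \<alpha>)"

definition map_conv_on :: "('n::finite \<Rightarrow> ('n \<Rightarrow> nat) \<Rightarrow> complex) \<Rightarrow> real \<Rightarrow> bool" where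
  "map_conv_on C r \<longleftrightarrow> (\<forall>z. (\<forall>j. cmod (z j) < r) \<longrightarrow> (\<forall>i. ps_conv (C i) z))"

definition map_eval :: "('n::finite \<Rightarrow> ('n \<Rightarrow> nat) \<Rightarrow> complex) \<Rightarrow> ('n \<Rightarrow> complex) \<Rightarrow> ('n \<Rightarrow> complex)" where
  "map_eval C z = (\<lambda>i. ps_eval (C i) z)"

definition Fcoeff :: "('n::finite \<Rightarrow> ('n \<Rightarrow> nat) \<Rightarrow> complex) \<Rightarrow> 'n \<Rightarrow> ('n \<Rightarrow> nat) \<Rightarrow> complex" where
  "Fcoeff H i \<alpha> = (if \<alpha> = unitidx i then 1 else 0)
                  - (if \<alpha> = (\<lambda>_. 0) then 0 else H i \<alpha> / of_nat (mfact \<alpha>))"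

definition linmat :: "('n::finite \<Rightarrow> ('n \<Rightarrow> nat) \<Rightarrow> complex) \<Rightarrow> complex^'n^'n" where
  "linmat H = (\<chi> i j. H i (unitidx j))"

primrec mpow :: "'a::comm_ring_1^'n::finite^'n \<Rightarrow> nat \<Rightarrow> 'a^'n^'n" where
  "mpow A 0 = mat 1"
| "mpow A (Suc k) = mpow A k ** A"

text \<open>n-type rooted planar trees: a vertex carries its type and the ordered list of its
  children; a leaf is a vertex with no children.\<close>
datatype 'n ttree = Node 'n "'n ttree list"

fun ttype :: "'n ttree \<Rightarrow> 'n" where
  "ttype (Node t cs) = t"

fun leafcnt :: "'n ttree \<Rightarrow> 'n \<Rightarrow> nat" where
  "leafcnt (Node t cs) j =
     (if cs = [] then (if t = j then 1 else 0) else sum_list (map (\<lambda>c. leafcnt c j) cs))"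

fun nverts :: "'n ttree \<Rightarrow> nat" where
  "nverts (Node t cs) = 1 + sum_list (map nverts cs)"

definition mu :: "'n ttree list \<Rightarrow> 'n \<Rightarrow> nat" where
  "mu cs j = length (filter (\<lambda>c. ttype c = j) cs)"

fun tweight :: "('n \<Rightarrow> ('n \<Rightarrow> nat) \<Rightarrow> complex) \<Rightarrow> 'n ttree \<Rightarrow> complex" where
  "tweight H (Node t cs) =
     (if cs = [] then 1
      else H t (mu cs) / of_nat (fact (length cs)) * prod_list (map (tweight H) cs))"

definition Strees :: "'n \<Rightarrow> ('n \<Rightarrow> nat) \<Rightarrow> 'n ttree set" where
  "Strees i \<alpha> = {T. ttype T = i \<and> leafcnt T = \<alpha>}"

text \<open>Partial sums of g_{i,\<alpha>} over the (finitely many) trees with at most N vertices;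
  the (in general infinite) tree sum g_{i,\<alpha>} is understood as the limit N \<rightarrow> \<infinity>.\<close>
definition gpartial :: "('n::finite \<Rightarrow> ('n \<Rightarrow> nat) \<Rightarrow> complex) \<Rightarrow> 'n \<Rightarrow> ('n \<Rightarrow> nat) \<Rightarrow> nat \<Rightarrow> complex" where
  "gpartial H i \<alpha> N = (\<Sum>T\<in>{T \<in> Strees i \<alpha>. nverts T \<le> N}. tweight H T)"

end

theory Submission
  imports Defs "HOL-Combinatorics.Multiset_Permutations"
begin

text \<open>
  Let \<open>a i \<alpha> m\<close> be the total weight of the trees with root type \<open>i\<close>, leaf counts \<open>\<alpha>\<close> and \<open>m\<close> vertices.
  Removing the root gives \<open>a (m + 1) = A a m + e m\<close>, where \<open>e\<close> collects the single leaf and the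
  trees whose root has at least two children, so \<open>\<Sum>m. |a m| \<le> (\<Sum>k. |A ^ k|) (\<Sum>m. |e m|)\<close>.
  As \<open>e\<close> is quadratic in the \<open>a\<close> with fewer vertices, induction on the number of vertices bounds
  \<open>\<Sum> |a i \<alpha> m| r ^ |\<alpha>|\<close> by \<open>O(r)\<close> for small \<open>r\<close>. Summing the recursion over all classes, and
  counting the \<open>|\<beta>|! / \<beta>!\<close> orderings of children of types \<open>\<beta>\<close>, yields \<open>F (G z) = z\<close>.
  Finally \<open>F\<close> is injective near 0, because \<open>1 - A\<close> is invertible and the rest is Lipschitz with a
  small constant; hence also \<open>G (F w) = w\<close>.
\<close>

section \<open>Sums over lists grouped by types\<close>

text \<open>Vertices with one child leave the leaf counts unchanged, so for \<alpha> \<noteq> 0 the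
  set \<open>Strees i \<alpha>\<close> is infinite, and a recursion on the degree |\<alpha>| alone
  cannot work. The number of vertices is the extra grading: it makes the classes finite, drops
  strictly from a tree to its children, and turns the limit of \<open>gpartial\<close> into the sum
  of an ordinary series. The entries of A may be large although its powers are summable, so the
  linear part is not a small perturbation. It is kept exact, as a linear recurrence or a linear
  fixed-point equation, and only the terms of degree at least two are estimated. The weights r ^
  |\<alpha>| and the monomials are multiplicative over the children of a vertex. Sums over lists of
  children therefore become power series in the coefficients of F, evaluated at sums over single
  trees; this serves both the estimate and the identity F (G z) = z.\<close>

lemma has_sum_fibresD:
  fixes g :: "'x \<Rightarrow> 'a :: {topological_comm_monoid_add,t3_space}"
  assumes "(g has_sum S) A" and "\<And>y. y \<in> B \<Longrightarrow> (g has_sum h y) {x\<in>A. \<phi> x = y}"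
    and "\<phi> ` A \<subseteq> B"
  shows "(h has_sum S) B"
proof -
  let ?Z = "Sigma B (\<lambda>y. {x\<in>A. \<phi> x = y})"
  have "((g \<circ> snd) has_sum S) ?Z \<longleftrightarrow> (g has_sum S) (snd ` ?Z)"
    by (rule has_sum_reindex[symmetric]) (auto simp: inj_on_def)
  moreover have "snd ` ?Z = A" using assms(3) by force
  ultimately have "((g \<circ> snd) has_sum S) ?Z" using assms(1) by simp
  then show ?thesis by (rule has_sum_SigmaD) (use assms(2) in simp)
qed

text \<open>Splitting a known sum along fibres is always allowed; building summability from the
  fibres is not. Nonnegativity of the terms supplies this converse, so norms are treated with this
  lemma before values are regrouped with \<open>has_sum_fibresD\<close>.\<close>

lemma summable_on_fibresI:
  fixes g :: "'x \<Rightarrow> real"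
  assumes "\<And>x. x \<in> A \<Longrightarrow> 0 \<le> g x" and "\<And>y. y \<in> B \<Longrightarrow> (g has_sum h y) {x\<in>A. \<phi> x = y}"
    and "\<phi> ` A \<subseteq> B" and "h summable_on B"
  shows "g summable_on A"
proof -
  let ?Z = "Sigma B (\<lambda>y. {x\<in>A. \<phi> x = y})"
  have "(g \<circ> snd) summable_on ?Z"
    by (rule summable_on_SigmaI[where g=h]) (use assms in auto)
  moreover have "(g \<circ> snd) summable_on ?Z \<longleftrightarrow> g summable_on (snd ` ?Z)"
    by (rule summable_on_reindex[symmetric]) (auto simp: inj_on_def)
  moreover have "snd ` ?Z = A" using assms(3) by force
  ultimately show ?thesis by simp
qed

lemma has_sum_Times_nonneg:
  fixes f :: "'x \<Rightarrow> real" and g :: "'y \<Rightarrow> real"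
  assumes "(f has_sum a) A" "(g has_sum b) B" "\<And>x. x \<in> A \<Longrightarrow> 0 \<le> f x" "\<And>y. y \<in> B \<Longrightarrow> 0 \<le> g y"
  shows "((\<lambda>(x,y). f x * g y) has_sum a * b) (A \<times> B)"
proof (rule has_sum_SigmaI[where g="\<lambda>x. f x * b"])
  show "((\<lambda>y. case (x, y) of (x, y) \<Rightarrow> f x * g y) has_sum f x * b) B" for x
    using has_sum_cmult_right[OF assms(2)] by simp
  show s: "((\<lambda>x. f x * b) has_sum a * b) A" by (rule has_sum_cmult_left[OF assms(1)])
  show "(\<lambda>(x, y). f x * g y) summable_on A \<times> B"
    by (rule summable_on_SigmaI[where g="\<lambda>x. f x * b"])
      (use has_sum_cmult_right[OF assms(2)] s assms(3,4) in \<open>auto simp: summable_on_def\<close>)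
qed

lemma has_sum_Times_abs:
  fixes f :: "'x \<Rightarrow> 'a::{real_normed_field,banach}" and g :: "'y \<Rightarrow> 'a"
  assumes "(f has_sum a) A" "(g has_sum b) B" "(\<lambda>x. norm (f x)) summable_on A" "(\<lambda>x. norm (g x)) summable_on B"
  shows "((\<lambda>(x,y). f x * g y) has_sum a * b) (A \<times> B)"
proof (rule has_sum_SigmaI[where g="\<lambda>x. f x * b"])
  show "((\<lambda>y. case (x, y) of (x, y) \<Rightarrow> f x * g y) has_sum f x * b) B" for x
    using has_sum_cmult_right[OF assms(2)] by simp
  show s: "((\<lambda>x. f x * b) has_sum a * b) A" by (rule has_sum_cmult_left[OF assms(1)])
  have "((\<lambda>(x,y). norm (f x) * norm (g y)) has_sum infsum (norm \<circ> f) A * infsum (norm \<circ> g) B) (A \<times> B)"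
    by (rule has_sum_Times_nonneg) (use assms(3,4) in \<open>auto simp: o_def\<close>)
  then have "(\<lambda>z. norm ((\<lambda>(x,y). f x * g y) z)) summable_on (A \<times> B)"
    by (auto simp: summable_on_def norm_mult case_prod_unfold)
  then show "(\<lambda>(x, y). f x * g y) summable_on A \<times> B" by (rule abs_summable_summable)
qed

lemma lists_with_types_Cons:
  "{ss. map fst ss = t # ts} = (\<lambda>(k,ss). (t,k) # ss) ` (UNIV \<times> {ss. map fst ss = ts})"
  by (auto simp: map_eq_Cons_conv image_iff)

text \<open>Lists with prescribed first components form a product of copies of the index type, one
  for each entry of \<open>ts\<close>. The claim is the distributive law for a product of infinite
  sums, by induction on the number of factors.\<close>

lemma has_sum_prod_list_nonneg:
  fixes f :: "'n \<times> 'k \<Rightarrow> real"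
  assumes "\<And>s. 0 \<le> f s" and "\<And>t. ((\<lambda>k. f (t,k)) has_sum y t) UNIV"
  shows "((\<lambda>ss. prod_list (map f ss)) has_sum prod_list (map y ts)) {ss. map fst ss = ts}"
proof (induction ts)
  case Nil
  then show ?case by (simp add: has_sum_finite_iff)
next
  case (Cons t ts)
  have "((\<lambda>(k,ss). f (t,k) * prod_list (map f ss)) has_sum y t * prod_list (map y ts))
          (UNIV \<times> {ss. map fst ss = ts})"
    by (rule has_sum_Times_nonneg[OF assms(2) Cons.IH])
       (use assms(1) in \<open>auto intro!: prod_list_nonneg\<close>)
  then show ?case unfolding lists_with_types_Cons
    by (subst has_sum_reindex) (auto simp: inj_on_def o_def case_prod_unfold)
qed

lemma norm_prod_list:
  fixes f :: "'b \<Rightarrow> 'a::real_normed_field"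
  shows "norm (prod_list (map f xs)) = prod_list (map (\<lambda>x. norm (f x)) xs)"
  by (induction xs) (auto simp: norm_mult)

lemma has_sum_prod_list:
  fixes f :: "'n \<times> 'k \<Rightarrow> 'a::{real_normed_field,banach}"
  assumes abs: "\<And>t. (\<lambda>k. norm (f (t,k))) summable_on UNIV"
    and sum: "\<And>t. ((\<lambda>k. f (t,k)) has_sum y t) UNIV"
  shows "((\<lambda>ss. prod_list (map f ss)) has_sum prod_list (map y ts)) {ss. map fst ss = ts}"
proof (induction ts)
  case Nil
  then show ?case by (simp add: has_sum_finite_iff)
next
  case (Cons t ts)
  have "(\<lambda>ss. prod_list (map (\<lambda>s. norm (f s)) ss)) summable_on {ss. map fst ss = ts}"
    by (rule has_sum_imp_summable, rule has_sum_prod_list_nonneg)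
       (use abs in \<open>auto intro: has_sum_infsum\<close>)
  then have "(\<lambda>ss. norm (prod_list (map f ss))) summable_on {ss. map fst ss = ts}"
    by (simp add: norm_prod_list)
  then have "((\<lambda>(k,ss). f (t,k) * prod_list (map f ss)) has_sum y t * prod_list (map y ts))
          (UNIV \<times> {ss. map fst ss = ts})"
    by (rule has_sum_Times_abs[OF sum Cons.IH abs])
  then show ?case unfolding lists_with_types_Cons
    by (subst has_sum_reindex) (auto simp: inj_on_def o_def case_prod_unfold)
qed

section \<open>Words over the types and multinomial counting\<close>

definition mdeg :: "('n::finite \<Rightarrow> nat) \<Rightarrow> nat" where
  "mdeg \<beta> = (\<Sum>j\<in>UNIV. \<beta> j)"

lemma prod_list_eq_prod_count:
  fixes y :: "'n::finite \<Rightarrow> 'a::comm_monoid_mult"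
  shows "prod_list (map y ts) = (\<Prod>j\<in>UNIV. y j ^ count_list ts j)"
proof (induction ts)
  case (Cons t ts)
  have "(\<Prod>j\<in>UNIV. y j ^ count_list (t # ts) j) = (\<Prod>j\<in>UNIV. (if j = t then y j else 1) * y j ^ count_list ts j)"
    by (rule prod.cong) auto
  then show ?case using Cons by (simp add: prod.distrib)
qed simp

lemma length_eq_mdeg_count: "length ts = mdeg (count_list (ts::'n::finite list))"
  by (simp add: mdeg_def sum_count_set[of ts UNIV])

text \<open>The lists with letter counts \<beta> are the arrangements of the multiset with
  multiplicities \<beta>, so their number is a multinomial coefficient. Since the type of letters is
  finite, every \<beta> is such a multiplicity function.\<close>

lemma card_lists_with_count:
  fixes \<beta> :: "'n::finite \<Rightarrow> nat"
  shows "finite {ts. count_list ts = \<beta>}"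
    and "card {ts. count_list ts = \<beta>} * mfact \<beta> = fact (mdeg \<beta>)"
proof -
  have c: "count (Abs_multiset \<beta>) = \<beta>" by simp
  have e: "{ts. count_list ts = \<beta>} = permutations_of_multiset (Abs_multiset \<beta>)"
    unfolding permutations_of_multiset_def by (auto simp: multiset_eq_iff count_mset)
  show "finite {ts. count_list ts = \<beta>}" unfolding e by simp
  have "(\<Prod>x\<in>set_mset (Abs_multiset \<beta>). fact (\<beta> x)) = mfact \<beta>"
    unfolding mfact_def by (rule prod.mono_neutral_left) (auto simp: set_mset_def)
  moreover have "size (Abs_multiset \<beta>) = mdeg \<beta>"
    unfolding size_multiset_overloaded_eq mdeg_def c
    by (rule sum.mono_neutral_left) (auto simp: set_mset_def)
  ultimately show "card {ts. count_list ts = \<beta>} * mfact \<beta> = fact (mdeg \<beta>)"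
    using card_permutations_of_multiset_aux[of "Abs_multiset \<beta>"] unfolding e by simp
qed

text \<open>All words with letter counts \<beta> contribute the same amount, and their multinomial
  number turns 1 / |\<beta>|! into 1 / \<beta>!. This reconciles the factorials in the tree weights
  with those in the coefficients of F.\<close>

lemma has_sum_count_fibre:
  fixes y :: "'n::finite \<Rightarrow> 'a::{real_normed_field,banach}"
  shows "((\<lambda>ts. c (count_list ts) / fact (length ts) * prod_list (map y ts)) has_sum
          c \<beta> / of_nat (mfact \<beta>) * (\<Prod>j\<in>UNIV. y j ^ \<beta> j)) {ts\<in>UNIV. count_list ts = \<beta>}"
proof -
  have "(\<Sum>ts | count_list ts = \<beta>. c (count_list ts) / fact (length ts) * prod_list (map y ts))
      = (\<Sum>ts | count_list ts = \<beta>. c \<beta> / fact (mdeg \<beta>) * (\<Prod>j\<in>UNIV. y j ^ \<beta> j))"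
    by (rule sum.cong) (auto simp: prod_list_eq_prod_count length_eq_mdeg_count)
  also have "\<dots> = of_nat (card {ts. count_list ts = \<beta>}) / fact (mdeg \<beta>) * (c \<beta> * (\<Prod>j\<in>UNIV. y j ^ \<beta> j))"
    by simp
  also have "(fact (mdeg \<beta>) :: 'a) = of_nat (card {ts. count_list ts = \<beta>}) * of_nat (mfact \<beta>)"
    by (metis card_lists_with_count(2) of_nat_fact of_nat_mult)
  also have "of_nat (card {ts. count_list ts = \<beta>}) / \<dots> = (1 / of_nat (mfact \<beta>) :: 'a)"
    using card_lists_with_count(2)[of \<beta>] by (auto simp: field_simps)
  finally show ?thesis
    by (auto simp: has_sum_finite_iff card_lists_with_count(1))
qed

text \<open>Two regroupings are composed: lists by their word of types, then words by their letter
  counts. The hypothesis \<open>conv\<close> evaluates the series at the sums of norms, since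
  absolute summability over all lists is what justifies both regroupings for the values.\<close>

lemma list_sums:
  fixes f :: "'n::finite \<times> 'k \<Rightarrow> 'a::{real_normed_field,banach}" and c :: "('n \<Rightarrow> nat) \<Rightarrow> 'a"
  assumes abs: "\<And>t. (\<lambda>k. norm (f (t,k))) summable_on UNIV"
    and conv: "(\<lambda>\<beta>. norm (c \<beta>) / real (mfact \<beta>) * (\<Prod>j\<in>UNIV. (\<Sum>\<^sub>\<infinity>k. norm (f (j,k))) ^ \<beta> j)) summable_on UNIV"
  defines "g \<equiv> \<lambda>ss. c (count_list (map fst ss)) / fact (length ss) * prod_list (map f ss)"
  shows "(\<lambda>ss. norm (g ss)) summable_on UNIV"
    and "((\<lambda>\<beta>. c \<beta> / of_nat (mfact \<beta>) * (\<Prod>j\<in>UNIV. (\<Sum>\<^sub>\<infinity>k. f (j,k)) ^ \<beta> j)) has_sum infsum g UNIV) UNIV"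
proof -
  define yn where "yn t = (\<Sum>\<^sub>\<infinity>k. norm (f (t,k)))" for t
  define y where "y t = (\<Sum>\<^sub>\<infinity>k. f (t,k))" for t
  have yn: "((\<lambda>k. norm (f (t,k))) has_sum yn t) UNIV" for t
    unfolding yn_def using abs by (auto intro: has_sum_infsum)
  have y: "((\<lambda>k. f (t,k)) has_sum y t) UNIV" for t
    unfolding y_def using abs_summable_summable[OF abs] by (auto intro: has_sum_infsum)
  have types: "((\<lambda>ss. norm (g ss)) has_sum norm (c (count_list ts)) / fact (length ts) * prod_list (map yn ts)) {ss\<in>UNIV. map fst ss = ts}" for ts
  proof -
    have "((\<lambda>ss. norm (c (count_list ts)) / fact (length ts) * prod_list (map (\<lambda>s. norm (f s)) ss)) has_sum
             norm (c (count_list ts)) / fact (length ts) * prod_list (map yn ts)) {ss\<in>UNIV. map fst ss = ts}"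
      by (intro has_sum_cmult_right) (use has_sum_prod_list_nonneg[of "\<lambda>s. norm (f s)" yn ts] yn in simp)
    then show ?thesis
      by (rule has_sum_cong[THEN iffD1, rotated])
         (auto simp: g_def norm_mult norm_divide norm_prod_list)
  qed
  have nts: "(\<lambda>ts. norm (c (count_list ts)) / fact (length ts) * prod_list (map yn ts)) summable_on UNIV"
  proof (rule summable_on_fibresI)
    show "((\<lambda>ts. norm (c (count_list ts)) / fact (length ts) * prod_list (map yn ts)) has_sum
          norm (c \<beta>) / real (mfact \<beta>) * (\<Prod>j\<in>UNIV. yn j ^ \<beta> j)) {ts\<in>UNIV. count_list ts = \<beta>}" for \<beta>
      using has_sum_count_fibre[of "\<lambda>b. norm (c b)" yn \<beta>] by simp
    have "yn t \<ge> 0" for t using yn by (rule has_sum_nonneg) auto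
    then show "0 \<le> norm (c (count_list ts)) / fact (length ts) * prod_list (map yn ts)" for ts
      by (auto intro!: divide_nonneg_nonneg mult_nonneg_nonneg prod_list_nonneg)
  qed (use conv in \<open>auto simp: yn_def\<close>)
  show abs_g: "(\<lambda>ss. norm (g ss)) summable_on UNIV"
    by (rule summable_on_fibresI[OF _ types _ nts]) auto
  have types': "(g has_sum c (count_list ts) / fact (length ts) * prod_list (map y ts)) {ss\<in>UNIV. map fst ss = ts}" for ts
  proof -
    have "((\<lambda>ss. c (count_list ts) / fact (length ts) * prod_list (map f ss)) has_sum
             c (count_list ts) / fact (length ts) * prod_list (map y ts)) {ss\<in>UNIV. map fst ss = ts}"
      by (intro has_sum_cmult_right) (use has_sum_prod_list[OF abs y] in simp)
    then show ?thesis
      by (rule has_sum_cong[THEN iffD1, rotated]) (auto simp: g_def)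
  qed
  have "((\<lambda>ts. c (count_list ts) / fact (length ts) * prod_list (map y ts)) has_sum infsum g UNIV) UNIV"
    by (rule has_sum_fibresD[OF has_sum_infsum[OF abs_summable_summable[OF abs_g]] types']) auto
  then have "((\<lambda>\<beta>. c \<beta> / of_nat (mfact \<beta>) * (\<Prod>j\<in>UNIV. y j ^ \<beta> j)) has_sum infsum g UNIV) UNIV"
    by (rule has_sum_fibresD[OF _ has_sum_count_fibre]) auto
  then show "((\<lambda>\<beta>. c \<beta> / of_nat (mfact \<beta>) * (\<Prod>j\<in>UNIV. (\<Sum>\<^sub>\<infinity>k. f (j,k)) ^ \<beta> j)) has_sum infsum g UNIV) UNIV"
    by (simp add: y_def)
qed

section \<open>Classes of trees\<close>

text \<open>The tree sum need not converge absolutely: only \<open>\<Sum>k. A ^ k\<close>, not the same series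
  for \<open>|A|\<close>, converges. Grouping the trees by root type, leaf counts and number of vertices lets the
  cancellation take place inside the finitely many trees of each class.\<close>

definition tclass :: "'n ttree \<Rightarrow> 'n \<times> ('n \<Rightarrow> nat) \<times> nat" where
  "tclass T = (ttype T, leafcnt T, nverts T)"

definition forest_total :: "('n \<times> ('n \<Rightarrow> nat) \<times> nat) list \<Rightarrow> ('n \<Rightarrow> nat) \<times> nat" where
  "forest_total ss = (\<lambda>j. \<Sum>s\<leftarrow>ss. fst (snd s) j, \<Sum>s\<leftarrow>ss. snd (snd s))"

definition class_weight :: "('n \<Rightarrow> ('n \<Rightarrow> nat) \<Rightarrow> complex) \<Rightarrow> 'n \<times> ('n \<Rightarrow> nat) \<times> nat \<Rightarrow> complex" where
  "class_weight H s = (\<Sum>T | tclass T = s. tweight H T)"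

text \<open>The total weight of the trees with root type \<open>i\<close> whose children, from left
  to right, lie in the classes \<open>ss\<close>, for nonempty \<open>ss\<close>: the root factor is
  common, and the rest factorises over the children.\<close>

definition forest_term :: "('n \<Rightarrow> ('n \<Rightarrow> nat) \<Rightarrow> complex) \<Rightarrow> 'n \<Rightarrow> ('n \<times> ('n \<Rightarrow> nat) \<times> nat) list \<Rightarrow> complex" where
  "forest_term H i ss = H i (count_list (map fst ss)) / fact (length ss) * prod_list (map (class_weight H) ss)"

definition forests :: "('n \<Rightarrow> nat) \<Rightarrow> nat \<Rightarrow> ('n \<times> ('n \<Rightarrow> nat) \<times> nat) list set" where
  "forests \<alpha> m = map tclass ` {cs. cs \<noteq> [] \<and> forest_total (map tclass cs) = (\<alpha>, m)}"

lemma nverts_pos: "nverts T \<ge> 1"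
  by (cases T) simp

lemma length_le_sum_nverts: "length cs \<le> (\<Sum>c\<leftarrow>cs. nverts c)"
proof (induction cs)
  case (Cons c cs)
  then show ?case using nverts_pos[of c] by simp
qed simp

text \<open>A tree with at most N + 1 vertices is a root type with at most N children, each having
  at most N vertices; there are finitely many types.\<close>

lemma finite_nverts_le: "finite {T :: 'n::finite ttree. nverts T \<le> N}"
proof (induction N)
  case 0
  have "{T :: 'n ttree. nverts T \<le> 0} = {}" by (metis (lifting) empty_Collect_eq le_zero_eq not_one_le_zero nverts_pos)
  then show ?case by (simp only: finite.emptyI)
next
  case (Suc N)
  have "{T :: 'n ttree. nverts T \<le> Suc N} \<subseteq> (\<lambda>(t,cs). Node t cs) ` (UNIV \<times> {cs. set cs \<subseteq> {T. nverts T \<le> N} \<and> length cs \<le> N})"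
  proof
    fix T :: "'n ttree" assume T: "T \<in> {T. nverts T \<le> Suc N}"
    obtain t cs where Tc: "T = Node t cs" by (cases T)
    have s: "(\<Sum>c\<leftarrow>cs. nverts c) \<le> N" using T Tc by simp
    moreover have "nverts c \<le> (\<Sum>c\<leftarrow>cs. nverts c)" if "c \<in> set cs" for c
      using that by (intro member_le_sum_list) auto
    ultimately show "T \<in> (\<lambda>(t,cs). Node t cs) ` (UNIV \<times> {cs. set cs \<subseteq> {T. nverts T \<le> N} \<and> length cs \<le> N})"
      using Tc length_le_sum_nverts[of cs] by force
  qed
  then show ?case
    by (rule finite_subset) (intro finite_imageI finite_cartesian_product finite_lists_length_le Suc; simp)
qed

lemma class_weight_eq_0: "s \<notin> range tclass \<Longrightarrow> class_weight H s = 0"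
  unfolding class_weight_def by (rule sum.neutral) auto

lemma prod_list_class_weight:
  fixes ss :: "('n::finite \<times> ('n \<Rightarrow> nat) \<times> nat) list"
  shows "prod_list (map (class_weight H) ss) = (\<Sum>cs | map tclass cs = ss. prod_list (map (tweight H) cs))"
proof (induction ss)
  case (Cons s ss)
  have e: "{cs. map tclass cs = s # ss} = (\<lambda>(T,cs). T # cs) ` ({T. tclass T = s} \<times> {cs. map tclass cs = ss})"
    by (auto simp: map_eq_Cons_conv)
  show ?case
    unfolding e
    by (subst sum.reindex)
      (auto simp: inj_on_def Cons class_weight_def sum_product sum.cartesian_product intro!: sum.cong)
qed simp

lemma mu_eq_count_list: "mu cs = count_list (map ttype cs)"
proof
  show "mu cs j = count_list (map ttype cs) j" for j
    by (induction cs) (auto simp: mu_def)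
qed

lemma fst_tclass [simp]: "fst (tclass T) = ttype T"
  by (simp add: tclass_def)

lemma tclass_Node:
  "cs \<noteq> [] \<Longrightarrow> tclass (Node t cs) = (t, fst (forest_total (map tclass cs)), Suc (snd (forest_total (map tclass cs))))"
  by (auto simp: tclass_def forest_total_def o_def)

lemma tclass_leaf: "tclass (Node t []) = (t, unitidx t, 1)"
  by (auto simp: tclass_def unitidx_def)

text \<open>Hanging the trees of a list below a common root is injective and yields a tree with one
  more vertex. The type of that root is irrelevant, hence \<open>undefined\<close>.\<close>

lemma finite_forest_lists:
  "finite {cs :: 'n::finite ttree list. cs \<noteq> [] \<and> forest_total (map tclass cs) = (\<alpha>, m)}" (is "finite ?C")
proof -
  have "Node undefined ` ?C \<subseteq> {T. nverts T \<le> Suc m}"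
    by (auto simp: forest_total_def tclass_def o_def)
  then have "finite (Node undefined ` ?C)" using finite_nverts_le finite_subset by blast
  then show ?thesis by (rule finite_imageD) (auto simp: inj_on_def)
qed

lemma finite_forests: "finite (forests \<alpha> m :: ('n::finite \<times> _) list set)"
  unfolding forests_def by (intro finite_imageI finite_forest_lists)

text \<open>If no list of trees realises \<open>ss\<close>, the product of the class weights is an
  empty sum. Hence the finite set \<open>forests\<close> and the full set of nonempty lists with the
  same total are interchangeable in sums.\<close>

lemma forest_term_eq_0:
  fixes ss :: "('n::finite \<times> ('n \<Rightarrow> nat) \<times> nat) list"
  assumes "ss \<noteq> []" "ss \<notin> forests (fst (forest_total ss)) (snd (forest_total ss))"
  shows "forest_term H i ss = 0"
proof -
  have "{cs. map tclass cs = ss} = {}" using assms by (auto simp: forests_def)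
  then show ?thesis by (simp add: forest_term_def prod_list_class_weight)
qed

lemma class_weight_0:
  fixes i :: 'n
  shows "class_weight H (i, \<alpha>, 0) = 0"
proof (rule class_weight_eq_0)
  have "(i, \<alpha>, 0) \<noteq> tclass T" for T using nverts_pos[of T] by (auto simp: tclass_def)
  then show "(i, \<alpha>, 0) \<notin> range tclass" by blast
qed

lemma class_weight_Suc:
  fixes i :: "'n::finite"
  shows "class_weight H (i, \<alpha>, Suc m) =
     (if m = 0 \<and> \<alpha> = unitidx i then 1 else 0) + (\<Sum>ss\<in>forests \<alpha> m. forest_term H i ss)"
proof -
  let ?C = "{cs :: 'n ttree list. cs \<noteq> [] \<and> forest_total (map tclass cs) = (\<alpha>, m)}"
  let ?L = "if m = 0 \<and> \<alpha> = unitidx i then {Node i []} else {}"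
  have "{T. tclass T = (i, \<alpha>, Suc m)} = Node i ` ?C \<union> ?L"
  proof (rule set_eqI)
    fix T :: "'n ttree"
    obtain t cs where T: "T = Node t cs" by (cases T)
    show "T \<in> {T. tclass T = (i, \<alpha>, Suc m)} \<longleftrightarrow> T \<in> Node i ` ?C \<union> ?L"
    proof (cases "cs = []")
      case True
      then show ?thesis by (auto simp: T tclass_leaf)
    next
      case False
      then show ?thesis by (auto simp: T tclass_Node prod_eq_iff image_iff)
    qed
  qed
  then have "class_weight H (i, \<alpha>, Suc m) = (\<Sum>T\<in>Node i ` ?C. tweight H T) + (\<Sum>T\<in>?L. tweight H T)"
    unfolding class_weight_def by (simp only:) (intro sum.union_disjoint; auto simp: finite_forest_lists)
  also have "(\<Sum>T\<in>?L. tweight H T) = (if m = 0 \<and> \<alpha> = unitidx i then 1 else 0)" by simp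
  also have "(\<Sum>T\<in>Node i ` ?C. tweight H T) = (\<Sum>cs\<in>?C. tweight H (Node i cs))"
    by (subst sum.reindex) (auto simp: inj_on_def)
  \<comment> \<open>Lists of children are grouped by their lists of classes; the factor at the root
    depends on the types and the number of children only, so it is constant on each group.\<close>
  also have "\<dots> = (\<Sum>ss\<in>map tclass ` ?C. \<Sum>cs | cs \<in> ?C \<and> map tclass cs = ss. tweight H (Node i cs))"
    by (rule sum.image_gen[OF finite_forest_lists])
  also have "\<dots> = (\<Sum>ss\<in>forests \<alpha> m. forest_term H i ss)"
    unfolding forests_def
  proof (rule sum.cong[OF refl])
    fix ss :: "('n \<times> ('n \<Rightarrow> nat) \<times> nat) list"
    assume ss: "ss \<in> map tclass ` ?C"
    then have "{cs. cs \<in> ?C \<and> map tclass cs = ss} = {cs. map tclass cs = ss}" by auto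
    then have "(\<Sum>cs | cs \<in> ?C \<and> map tclass cs = ss. tweight H (Node i cs))
         = (\<Sum>cs | map tclass cs = ss. tweight H (Node i cs))" by simp
    also have "\<dots> = (\<Sum>cs | map tclass cs = ss. H i (count_list (map fst ss)) / fact (length ss) * prod_list (map (tweight H) cs))"
    proof (rule sum.cong[OF refl])
      fix cs assume "cs \<in> {cs. map tclass cs = ss}"
      then have "ss = map tclass cs" by simp
      moreover from this ss have "cs \<noteq> []" by auto
      ultimately show "tweight H (Node i cs) = H i (count_list (map fst ss)) / fact (length ss) * prod_list (map (tweight H) cs)"
        by (simp add: mu_eq_count_list o_def)
    qed
    also have "\<dots> = forest_term H i ss"
      by (simp only: forest_term_def prod_list_class_weight sum_distrib_left)
    finally show "(\<Sum>cs | cs \<in> ?C \<and> map tclass cs = ss. tweight H (Node i cs)) = forest_term H i ss" .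
  qed
  finally show ?thesis by simp
qed

text \<open>The finite recursion is extended by zero terms to the whole fibre of
  \<open>forest_total\<close>, the shape needed for regrouping a sum over all lists by their
  totals.\<close>

lemma has_sum_forest_term:
  fixes i :: "'n::finite"
  shows "(forest_term H i has_sum
     class_weight H (i, \<alpha>, Suc m) - (if m = 0 \<and> \<alpha> = unitidx i then 1 else 0)) {ss. ss \<noteq> [] \<and> forest_total ss = (\<alpha>, m)}"
proof (rule has_sum_finite_neutralI[of "forests \<alpha> m"])
  show "class_weight H (i, \<alpha>, Suc m) - (if m = 0 \<and> \<alpha> = unitidx i then 1 else 0) = sum (forest_term H i) (forests \<alpha> m)"
    by (simp add: class_weight_Suc)
  show "forests \<alpha> m \<subseteq> {ss. ss \<noteq> [] \<and> forest_total ss = (\<alpha>, m)}" by (auto simp: forests_def)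
qed (use forest_term_eq_0[of _ H i] in \<open>auto simp: finite_forests\<close>)

lemma count_list_single: "count_list [j] = unitidx j"
  by (auto simp: unitidx_def fun_eq_iff)

text \<open>A single child inherits all leaves and all vertices but the root, so its class is
  determined by its type. Such roots act on the vector of weights, indexed by root type, as
  multiplication by \<open>linmat H\<close>.\<close>

lemma class_weight_Suc_linear:
  fixes i :: "'n::finite"
  shows "class_weight H (i, \<alpha>, Suc m) =
     (\<Sum>j\<in>UNIV. H i (unitidx j) * class_weight H (j, \<alpha>, m)) +
     ((if m = 0 \<and> \<alpha> = unitidx i then 1 else 0) + (\<Sum>ss | ss \<in> forests \<alpha> m \<and> length ss \<ge> 2. forest_term H i ss))"
proof -
  let ?U = "range (\<lambda>j::'n. [(j, \<alpha>, m)])"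
  have "(\<Sum>ss | ss \<in> forests \<alpha> m \<and> \<not> length ss \<ge> 2. forest_term H i ss) = (\<Sum>ss\<in>?U. forest_term H i ss)"
  proof (rule sum.mono_neutral_left)
    show "{ss \<in> forests \<alpha> m. \<not> 2 \<le> length ss} \<subseteq> ?U"
    proof
      fix ss :: "('n \<times> ('n \<Rightarrow> nat) \<times> nat) list"
      assume a: "ss \<in> {ss \<in> forests \<alpha> m. \<not> 2 \<le> length ss}"
      then have "ss \<noteq> []" "forest_total ss = (\<alpha>, m)" by (auto simp: forests_def)
      moreover from this a have "length ss = 1" by (cases ss) (auto simp: Suc_le_eq)
      ultimately show "ss \<in> ?U" by (auto simp: length_Suc_conv forest_total_def)
    qed
    \<comment> \<open>Singletons missing from \<open>forests\<close> are not realised by any tree,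
      so including them adds only zeros.\<close>
    show "\<forall>ss\<in>?U - {ss \<in> forests \<alpha> m. \<not> 2 \<le> length ss}. forest_term H i ss = 0"
      using forest_term_eq_0[of "[(_, \<alpha>, m)]" H i] by (auto simp: forest_total_def)
  qed simp
  also have "\<dots> = (\<Sum>j\<in>UNIV. H i (unitidx j) * class_weight H (j, \<alpha>, m))"
    by (subst sum.reindex) (auto simp: inj_on_def forest_term_def count_list_single simp del: count_list.simps)
  finally have u: "(\<Sum>ss | ss \<in> forests \<alpha> m \<and> \<not> length ss \<ge> 2. forest_term H i ss) = (\<Sum>j\<in>UNIV. H i (unitidx j) * class_weight H (j, \<alpha>, m))" .
  have "(\<Sum>ss\<in>forests \<alpha> m. forest_term H i ss) = (\<Sum>ss | ss \<in> forests \<alpha> m \<and> length ss \<ge> 2. forest_term H i ss)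
      + (\<Sum>ss | ss \<in> forests \<alpha> m \<and> \<not> length ss \<ge> 2. forest_term H i ss)"
    by (subst sum.union_disjoint[symmetric])
       (auto intro!: sum.cong intro: finite_subset[OF _ finite_forests[of \<alpha> m]])
  then show ?thesis by (simp add: class_weight_Suc u)
qed

lemma gpartial_eq_sum: 
  fixes i :: "'n::finite"
  shows "gpartial H i \<alpha> N = (\<Sum>m\<le>N. class_weight H (i, \<alpha>, m))"
proof -
  let ?X = "{T \<in> Strees i \<alpha>. nverts T \<le> N}"
  have "finite ?X" by (rule finite_subset[OF _ finite_nverts_le[of N]]) auto
  then have "gpartial H i \<alpha> N = (\<Sum>m\<in>{..N}. \<Sum>T | T \<in> ?X \<and> nverts T = m. tweight H T)"
    unfolding gpartial_def by (intro sum.group[symmetric]) auto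
  also have "\<dots> = (\<Sum>m\<le>N. class_weight H (i, \<alpha>, m))"
    unfolding class_weight_def by (intro sum.cong) (auto simp: tclass_def Strees_def)
  finally show ?thesis .
qed

section \<open>Matrices with summable powers\<close>

text \<open>Submultiplicative and compatible with \<open>l1_norm\<close>. The sum norms are chosen
  because the estimates for trees add up the contributions of all root types.\<close>

definition entry_norm :: "complex^'n::finite^'n \<Rightarrow> real" where
  "entry_norm A = (\<Sum>i\<in>UNIV. \<Sum>j\<in>UNIV. cmod (A $ i $ j))"

definition l1_norm :: "complex^'n::finite \<Rightarrow> real" where
  "l1_norm x = (\<Sum>i\<in>UNIV. cmod (x $ i))"

lemma entry_norm_nonneg: "0 \<le> entry_norm A"
  by (simp add: entry_norm_def sum_nonneg)

lemma l1_norm_nonneg: "0 \<le> l1_norm x"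
  by (simp add: l1_norm_def sum_nonneg)

lemma l1_norm_add: "l1_norm (x + y) \<le> l1_norm x + l1_norm y"
  by (simp add: l1_norm_def sum.distrib[symmetric] norm_triangle_ineq sum_mono)

lemma l1_norm_sum: "l1_norm (\<Sum>k\<in>S. f k) \<le> (\<Sum>k\<in>S. l1_norm (f k))"
proof (induction S rule: infinite_finite_induct)
  case (insert k S)
  then show ?case using l1_norm_add[of "f k" "\<Sum>k\<in>S. f k"] by simp
qed (auto simp: l1_norm_def)

lemma l1_norm_matrix_vector_mult: "l1_norm (A *v x) \<le> entry_norm A * l1_norm x"
proof -
  have "l1_norm (A *v x) \<le> (\<Sum>i\<in>UNIV. \<Sum>j\<in>UNIV. cmod (A $ i $ j) * cmod (x $ j))"
    unfolding l1_norm_def matrix_vector_mult_def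
    by (auto intro!: sum_mono norm_sum[THEN order_trans] simp: norm_mult)
  also have "\<dots> \<le> (\<Sum>i\<in>UNIV. \<Sum>j\<in>UNIV. cmod (A $ i $ j) * l1_norm x)"
    unfolding l1_norm_def by (intro sum_mono mult_left_mono member_le_sum) auto
  finally show ?thesis by (simp add: entry_norm_def sum_distrib_right)
qed

lemma entry_norm_mult: "entry_norm (A ** B) \<le> entry_norm A * entry_norm B"
proof -
  have "entry_norm (A ** B) \<le> (\<Sum>i\<in>UNIV. \<Sum>j\<in>UNIV. \<Sum>k\<in>UNIV. cmod (A $ i $ k) * cmod (B $ k $ j))"
    unfolding entry_norm_def matrix_matrix_mult_def
    by (auto intro!: sum_mono norm_sum[THEN order_trans] simp: norm_mult)
  also have "\<dots> = (\<Sum>i\<in>UNIV. \<Sum>k\<in>UNIV. cmod (A $ i $ k) * (\<Sum>j\<in>UNIV. cmod (B $ k $ j)))"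
    unfolding sum_distrib_left by (intro sum.cong refl sum.swap)
  also have "\<dots> \<le> (\<Sum>i\<in>UNIV. \<Sum>k\<in>UNIV. cmod (A $ i $ k) * entry_norm B)"
    unfolding entry_norm_def
    by (intro sum_mono mult_left_mono member_le_sum[where f="\<lambda>k. \<Sum>j\<in>UNIV. cmod (B $ k $ j)"]) (auto intro: sum_nonneg)
  finally show ?thesis by (simp add: entry_norm_def sum_distrib_right)
qed

lemma mpow_add: "mpow A (m + n) = mpow A m ** mpow A n"
  by (induction n) (simp_all add: matrix_mul_assoc)

lemma mpow_Suc_left: "mpow A (Suc k) = A ** mpow A k"
  using mpow_add[of A 1 k] by simp

lemma entry_norm_mpow_tendsto_0:
  assumes "summable (\<lambda>k. mpow A k)"
  shows "(\<lambda>k. entry_norm (mpow A k)) \<longlonglongrightarrow> 0"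
proof -
  have "(\<lambda>k. mpow A k) \<longlonglongrightarrow> 0" using assms by (rule summable_LIMSEQ_zero)
  then have "(\<lambda>k. entry_norm (mpow A k)) \<longlonglongrightarrow> (\<Sum>i\<in>UNIV. \<Sum>j\<in>UNIV. cmod ((0::complex^'a^'a) $ i $ j))"
    unfolding entry_norm_def by (intro tendsto_intros)
  then show ?thesis by simp
qed

text \<open>Once some power has norm at most 1/2, the partial sums satisfy \<open>S N \<le> D + S N / 2\<close>.\<close>

lemma entry_norm_mpow_sum_bounded:
  assumes "summable (\<lambda>k. mpow A k)"
  obtains C where "C > 0" "\<And>N. (\<Sum>k<N. entry_norm (mpow A k)) \<le> C"
proof -
  obtain p where p: "entry_norm (mpow A p) < 1/2"
    using order_tendstoD(2)[OF entry_norm_mpow_tendsto_0[OF assms], of "1/2"]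
    by (auto simp: eventually_sequentially)
  define S where "S N = (\<Sum>k<N. entry_norm (mpow A k))" for N
  have S0: "S N \<ge> 0" for N by (simp add: S_def sum_nonneg entry_norm_nonneg)
  have bound: "S N \<le> 2 * S p" for N
  proof -
    have "S N \<le> S (N + p)" unfolding S_def by (rule sum_mono2) (auto simp: entry_norm_nonneg)
    also have "\<dots> = S p + (\<Sum>k<N. entry_norm (mpow A (k + p)))"
      unfolding S_def by (induction N) simp_all
    also have "(\<Sum>k<N. entry_norm (mpow A (k + p))) \<le> (\<Sum>k<N. entry_norm (mpow A k) * (1/2))"
    proof (rule sum_mono)
      fix k
      have "entry_norm (mpow A (k + p)) \<le> entry_norm (mpow A k) * entry_norm (mpow A p)"
        unfolding mpow_add by (rule entry_norm_mult)
      also have "\<dots> \<le> entry_norm (mpow A k) * (1/2)"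
        using p by (intro mult_left_mono) (auto simp: entry_norm_nonneg)
      finally show "entry_norm (mpow A (k + p)) \<le> entry_norm (mpow A k) * (1/2)" .
    qed
    also have "\<dots> = S N / 2" by (simp add: S_def sum_divide_distrib)
    finally show ?thesis by simp
  qed
  show ?thesis
  proof (rule that)
    show "2 * S p + 1 > 0" using S0[of p] by simp
    show "(\<Sum>k<N. entry_norm (mpow A k)) \<le> 2 * S p + 1" for N
      using bound[of N] unfolding S_def[of N, symmetric] by simp
  qed
qed

lemma matrix_vector_mult_sum: "A *v (\<Sum>k\<in>S. f k) = (\<Sum>k\<in>S. A *v f k)"
  by (induction S rule: infinite_finite_induct) (auto simp: matrix_vector_right_distrib)

text \<open>Unrolling the recurrence gives a convolution of the powers of A with \<open>e\<close>, a
  discrete Duhamel formula. Summed over m, it ranges over a triangle; enlarging the triangle to a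
  square separates the factors, so the cost is C whatever the size of A itself.\<close>

lemma linear_recurrence_bound:
  fixes v e :: "nat \<Rightarrow> complex^'n::finite"
  assumes "v 0 = 0" and rec: "\<And>m. v (Suc m) = A *v v m + e m"
    and C: "\<And>N. (\<Sum>k<N. entry_norm (mpow A k)) \<le> C"
  shows "(\<Sum>m\<le>N. l1_norm (v m)) \<le> C * (\<Sum>m<N. l1_norm (e m))"
proof -
  have v: "v (Suc m) = (\<Sum>k\<le>m. mpow A k *v e (m - k))" for m
  proof (induction m)
    case 0
    then show ?case using rec[of 0] assms(1) by simp
  next
    case (Suc m)
    have "A *v v (Suc m) = (\<Sum>k\<le>m. mpow A (Suc k) *v e (m - k))"
      unfolding Suc matrix_vector_mult_sum mpow_Suc_left by (simp add: matrix_vector_mul_assoc)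
    then show ?case unfolding rec[of "Suc m"] by (subst sum.atMost_Suc_shift) (simp del: mpow.simps(2))
  qed
  have "(\<Sum>m\<le>N. l1_norm (v m)) = (\<Sum>m<N. l1_norm (v (Suc m)))"
    using assms(1) by (simp add: lessThan_Suc_atMost[symmetric] sum.lessThan_Suc_shift l1_norm_def del: sum.lessThan_Suc)
  also have "\<dots> \<le> (\<Sum>m<N. \<Sum>k\<le>m. entry_norm (mpow A k) * l1_norm (e (m - k)))"
    unfolding v by (intro sum_mono order_trans[OF l1_norm_sum] l1_norm_matrix_vector_mult)
  also have "\<dots> = (\<Sum>(k,j)\<in>{(k,j). k + j < N}. entry_norm (mpow A k) * l1_norm (e j))"
    by (rule sum.triangle_reindex[symmetric])
  also have "\<dots> \<le> (\<Sum>(k,j)\<in>{..<N} \<times> {..<N}. entry_norm (mpow A k) * l1_norm (e j))"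
    by (rule sum_mono2) (auto simp: entry_norm_nonneg l1_norm_nonneg)
  also have "\<dots> = (\<Sum>k<N. entry_norm (mpow A k)) * (\<Sum>m<N. l1_norm (e m))"
    by (simp add: sum_product sum.cartesian_product)
  also have "\<dots> \<le> C * (\<Sum>m<N. l1_norm (e m))"
    by (intro mult_right_mono C sum_nonneg l1_norm_nonneg)
  finally show ?thesis .
qed

text \<open>Iterating the equation N times leaves a remainder \<open>mpow A N *v x\<close>, which
  tends to 0, and a partial Neumann sum applied to \<open>q\<close>. Thus C bounds the inverse of 1
  - A without that inverse being constructed.\<close>

lemma linear_fixpoint_bound:
  fixes x q :: "complex^'n::finite"
  assumes x: "x = A *v x + q"
    and C: "\<And>N. (\<Sum>k<N. entry_norm (mpow A k)) \<le> C"
    and lim: "(\<lambda>k. entry_norm (mpow A k)) \<longlonglongrightarrow> 0"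
  shows "l1_norm x \<le> C * l1_norm q"
proof -
  have it: "x = mpow A N *v x + (\<Sum>k<N. mpow A k *v q)" for N
  proof (induction N)
    case (Suc N)
    have "mpow A N *v x = mpow A (Suc N) *v x + mpow A N *v q"
      by (subst x) (simp add: matrix_vector_right_distrib matrix_vector_mul_assoc)
    with Suc show ?case by (simp add: algebra_simps)
  qed simp
  have "l1_norm x \<le> entry_norm (mpow A N) * l1_norm x + C * l1_norm q" for N
  proof -
    have "l1_norm x \<le> l1_norm (mpow A N *v x) + l1_norm (\<Sum>k<N. mpow A k *v q)"
      by (subst it[of N]) (rule l1_norm_add)
    also have "\<dots> \<le> entry_norm (mpow A N) * l1_norm x + (\<Sum>k<N. entry_norm (mpow A k) * l1_norm q)"
      by (intro add_mono l1_norm_matrix_vector_mult order_trans[OF l1_norm_sum] sum_mono)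
    also have "(\<Sum>k<N. entry_norm (mpow A k) * l1_norm q) \<le> C * l1_norm q"
      unfolding sum_distrib_right[symmetric] by (intro mult_right_mono C l1_norm_nonneg)
    finally show ?thesis by simp
  qed
  moreover have "(\<lambda>N. entry_norm (mpow A N) * l1_norm x + C * l1_norm q) \<longlonglongrightarrow> 0 * l1_norm x + C * l1_norm q"
    by (intro tendsto_intros lim)
  ultimately show ?thesis by (intro LIMSEQ_le_const) auto
qed

section \<open>Monomials and majorants\<close>

lemma monom_const: "(\<Prod>j\<in>UNIV. (x::'a::comm_semiring_1) ^ \<beta> j) = x ^ mdeg \<beta>"
  by (simp add: mdeg_def power_sum)

lemma mdeg_eq_0_iff: "mdeg \<beta> = 0 \<longleftrightarrow> \<beta> = (\<lambda>_. 0)"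
  by (auto simp: mdeg_def fun_eq_iff)

lemma mdeg_0 [simp]: "mdeg (\<lambda>_. 0) = 0"
  by (simp add: mdeg_def)

lemma mdeg_unitidx [simp]: "mdeg (unitidx j) = 1"
  by (simp add: mdeg_def unitidx_def)

lemma mdeg_eq_1D:
  assumes "mdeg \<beta> = 1" shows "\<beta> \<in> range unitidx"
proof -
  have "\<exists>j. \<beta> j \<noteq> 0" using assms mdeg_eq_0_iff[of \<beta>] by (auto simp: fun_eq_iff)
  then obtain j where j: "\<beta> j \<noteq> 0" by auto
  have "\<beta> j + sum \<beta> (UNIV - {j}) = 1" using assms by (simp add: mdeg_def sum.remove[of UNIV j])
  then have "\<beta> j = 1" "sum \<beta> (UNIV - {j}) = 0" using j by linarith+
  then have "\<beta> = unitidx j" by (auto simp: fun_eq_iff unitidx_def)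
  then show ?thesis by simp
qed

lemma mfact_unitidx [simp]: "mfact (unitidx j) = 1"
  unfolding mfact_def unitidx_def by (rule prod.neutral) auto

lemma monom_unitidx [simp]: "monom y (unitidx j) = y j"
proof -
  have "monom y (unitidx j) = (\<Prod>k\<in>UNIV. if k = j then y k else 1)"
    unfolding monom_def unitidx_def by (rule prod.cong) auto
  then show ?thesis by simp
qed

lemma cmod_monom_le:
  assumes "\<And>j. cmod (y j) \<le> r"
  shows "cmod (monom y \<beta>) \<le> r ^ mdeg \<beta>"
proof -
  have "cmod (monom y \<beta>) \<le> (\<Prod>j\<in>UNIV. r ^ \<beta> j)"
    unfolding monom_def prod_norm[symmetric] norm_power
    by (intro prod_mono) (auto intro: power_mono assms)
  then show ?thesis by (simp add: monom_const)
qed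

text \<open>A monomial is a product along a word with letter counts \<beta>. Replacing v by w one
  letter at a time costs at most X times the bound r for each of the remaining letters.\<close>

lemma monom_diff_bound:
  assumes v: "\<And>j. cmod (v j) \<le> r" and w: "\<And>j. cmod (w j) \<le> r" and d: "\<And>j. cmod (v j - w j) \<le> X"
    and r: "0 \<le> r" and X: "0 \<le> X"
  shows "cmod (monom v \<beta> - monom w \<beta>) \<le> real (mdeg \<beta>) * r ^ (mdeg \<beta> - 1) * X"
proof -
  have l: "cmod (prod_list (map v ts) - prod_list (map w ts)) \<le> real (length ts) * r ^ (length ts - 1) * X" for ts
  proof (induction ts)
    case (Cons t ts)
    have pv: "cmod (prod_list (map v ts)) \<le> r ^ length ts"
      by (induction ts) (auto simp: norm_mult intro!: mult_mono v r)
    have e: "v t * prod_list (map v ts) - w t * prod_list (map w ts) =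
      (v t - w t) * prod_list (map v ts) + w t * (prod_list (map v ts) - prod_list (map w ts))"
      by (simp add: algebra_simps)
    have "cmod (v t * prod_list (map v ts) - w t * prod_list (map w ts)) \<le>
       X * r ^ length ts + r * (real (length ts) * r ^ (length ts - 1) * X)"
      unfolding e using pv Cons.IH
      by (intro norm_triangle_mono) (auto simp: norm_mult intro!: mult_mono d w X r)
    \<comment> \<open>For empty \<open>ts\<close> the truncated exponent is harmless, because the
      factor \<open>length ts\<close> vanishes.\<close>
    also have "r * (real (length ts) * r ^ (length ts - 1) * X) = real (length ts) * r ^ length ts * X"
      by (cases ts) auto
    finally show ?case by (simp add: algebra_simps)
  qed simp
  \<comment> \<open>A positive multinomial number provides a word with the prescribed letter
    counts.\<close>
  have "card {ts. count_list ts = \<beta>} \<noteq> 0"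
    using card_lists_with_count(2)[of \<beta>] by (metis fact_nonzero mult_is_0)
  then have "{ts. count_list ts = \<beta>} \<noteq> {}" by (metis card.empty)
  then obtain ts where "count_list ts = \<beta>" by blast
  then show ?thesis
    using l[of ts] by (simp add: prod_list_eq_prod_count monom_def length_eq_mdeg_count)
qed

section \<open>Domination by majorant series\<close>

lemma infsum_cmult_bound: 
  fixes f g :: "'b \<Rightarrow> real"
  assumes "g summable_on A" "\<And>x. x \<in> A \<Longrightarrow> 0 \<le> f x" "\<And>x. x \<in> A \<Longrightarrow> f x \<le> c * g x"
  shows "f summable_on A" "infsum f A \<le> c * infsum g A"
proof -
  have cg: "(\<lambda>x. c * g x) summable_on A" by (intro summable_on_cmult_right assms)
  show f: "f summable_on A" by (rule summable_on_comparison_test[OF cg]) (use assms in auto)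
  have "infsum f A \<le> infsum (\<lambda>x. c * g x) A" by (rule infsum_mono[OF f cg]) (use assms in auto)
  then show "infsum f A \<le> c * infsum g A" by (simp add: infsum_cmult_right assms)
qed

text \<open>Two values of \<open>d\<close> matter: 1 removes the constant coefficient, as F does,
  and 2 leaves the part of degree at least two.\<close>

definition trunc :: "nat \<Rightarrow> ('n::finite \<Rightarrow> ('n \<Rightarrow> nat) \<Rightarrow> complex) \<Rightarrow> 'n \<Rightarrow> ('n \<Rightarrow> nat) \<Rightarrow> complex" where
  "trunc d H i \<beta> = (if mdeg \<beta> \<ge> d then H i \<beta> else 0)"

definition majorant :: "nat \<Rightarrow> ('n::finite \<Rightarrow> ('n \<Rightarrow> nat) \<Rightarrow> complex) \<Rightarrow> 'n \<Rightarrow> real \<Rightarrow> ('n \<Rightarrow> nat) \<Rightarrow> real" where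
  "majorant d H i x \<beta> = cmod (trunc d H i \<beta>) / real (mfact \<beta>) * x ^ mdeg \<beta>"

lemma majorant_nonneg: "0 \<le> x \<Longrightarrow> 0 \<le> majorant d H i x \<beta>"
  by (simp add: majorant_def)

text \<open>Every surviving term has degree at least d, so shrinking the radius from r to x gains at
  least d factors x / r. With d = 2 this is the quadratic gain that closes the estimate for the
  trees.\<close>

lemma majorant_le_scale:
  assumes "0 \<le> x" "x \<le> r" "0 < r"
  shows "majorant d H i x \<beta> \<le> (x / r) ^ d * majorant d H i r \<beta>"
proof (cases "mdeg \<beta> \<ge> d")
  case True
  have "x ^ mdeg \<beta> = (x / r) ^ mdeg \<beta> * r ^ mdeg \<beta>"
    using assms by (simp add: power_divide)
  also have "\<dots> \<le> (x / r) ^ d * r ^ mdeg \<beta>"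
    using assms True by (intro mult_right_mono power_decreasing) auto
  finally have "cmod (trunc d H i \<beta>) / real (mfact \<beta>) * x ^ mdeg \<beta> \<le> cmod (trunc d H i \<beta>) / real (mfact \<beta>) * ((x / r) ^ d * r ^ mdeg \<beta>)"
    by (rule mult_left_mono) simp
  then show ?thesis by (simp add: majorant_def mult_ac)
qed (simp add: majorant_def trunc_def)

text \<open>Enlarging \<open>E\<close> to all lists turns the sum into the power series with
  coefficients |H| / \<beta>!, evaluated at the totals of \<open>f\<close> for each type. These
  totals are at most x, and the series is monotone in them.\<close>

lemma forest_sum_bound:
  fixes f :: "'n::finite \<times> 'k \<Rightarrow> real"
  assumes f0: "\<And>s. 0 \<le> f s" and fsum: "\<And>t. (\<lambda>k. f (t,k)) summable_on UNIV"
    and fle: "\<And>t. (\<Sum>\<^sub>\<infinity>k. f (t,k)) \<le> x"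
    and conv: "majorant d H i x summable_on UNIV" and "finite E"
  shows "(\<Sum>ss\<in>E. cmod (trunc d H i (count_list (map fst ss))) / fact (length ss) * prod_list (map f ss))
         \<le> infsum (majorant d H i x) UNIV"
proof -
  define c where "c \<beta> = cmod (trunc d H i \<beta>)" for \<beta>
  define y where "y t = (\<Sum>\<^sub>\<infinity>k. f (t,k))" for t
  have y0: "0 \<le> y t" for t unfolding y_def by (rule infsum_nonneg) (use f0 in auto)
  have le: "c \<beta> / real (mfact \<beta>) * (\<Prod>j\<in>UNIV. y j ^ \<beta> j) \<le> majorant d H i x \<beta>" for \<beta>
  proof -
    have "(\<Prod>j\<in>UNIV. y j ^ \<beta> j) \<le> (\<Prod>j\<in>UNIV. x ^ \<beta> j)"
      using y0 fle by (intro prod_mono) (auto intro: power_mono simp: y_def)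
    then show ?thesis unfolding majorant_def c_def monom_const by (intro mult_left_mono) auto
  qed
  have ge: "0 \<le> c \<beta> / real (mfact \<beta>) * (\<Prod>j\<in>UNIV. y j ^ \<beta> j)" for \<beta>
    by (auto simp: c_def intro!: mult_nonneg_nonneg divide_nonneg_nonneg prod_nonneg zero_le_power y0)
  have s: "(\<lambda>\<beta>. norm (c \<beta>) / real (mfact \<beta>) * (\<Prod>j\<in>UNIV. (\<Sum>\<^sub>\<infinity>k. norm (f (j,k))) ^ \<beta> j)) summable_on UNIV"
    using summable_on_comparison_test[OF conv le ge] f0 by (simp add: c_def y_def)
  define g where "g ss = c (count_list (map fst ss)) / fact (length ss) * prod_list (map f ss)" for ss
  have fs: "(\<lambda>k. norm (f (t, k))) summable_on UNIV" for t using fsum f0 by simp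
  have g0: "0 \<le> g ss" for ss
    by (auto simp: g_def c_def intro!: mult_nonneg_nonneg divide_nonneg_nonneg prod_list_nonneg f0)
  have "(\<lambda>ss. norm (g ss)) summable_on UNIV"
    unfolding g_def by (rule list_sums(1)[OF fs s])
  then have "g summable_on UNIV" using g0 by simp
  then have "sum g E \<le> infsum g UNIV"
    by (rule finite_sum_le_infsum) (use g0 \<open>finite E\<close> in auto)
  also have "infsum g UNIV = (\<Sum>\<^sub>\<infinity>\<beta>. c \<beta> / real (mfact \<beta>) * (\<Prod>j\<in>UNIV. y j ^ \<beta> j))"
    unfolding y_def g_def by (rule infsumI[OF list_sums(2)[OF fs s], symmetric])
  also have "\<dots> \<le> infsum (majorant d H i x) UNIV"
    by (rule infsum_mono[OF summable_on_comparison_test[OF conv le ge] conv le])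
  finally show ?thesis by (simp add: g_def c_def)
qed

section \<open>Convergence of the tree series\<close>

lemma forest_total_Nil: "forest_total [] = (\<lambda>_. 0, 0)"
  by (simp add: forest_total_def)

lemma forest_total_Cons:
  "forest_total (s # ss) = (\<lambda>j. fst (snd s) j + fst (forest_total ss) j, snd (snd s) + snd (forest_total ss))"
  by (simp add: forest_total_def)

lemma mdeg_add: "mdeg (\<lambda>j. \<alpha> j + \<beta> j) = mdeg \<alpha> + mdeg \<beta>"
  by (simp add: mdeg_def sum.distrib)

lemma monom_add: "monom z (\<lambda>j. \<alpha> j + \<beta> j) = monom z \<alpha> * monom z \<beta>"
  by (simp add: monom_def power_add prod.distrib)

lemma prod_list_mult_monom:
  "prod_list (map (\<lambda>s. w s * monom z (fst (snd s))) ss) = prod_list (map w ss) * monom z (fst (forest_total ss))"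
  by (induction ss) (auto simp: forest_total_Nil forest_total_Cons monom_add, simp add: monom_def)

lemma prod_list_mult_power_mdeg:
  fixes r :: "'a::comm_semiring_1"
  shows "prod_list (map (\<lambda>s. w s * r ^ mdeg (fst (snd s))) ss) = prod_list (map w ss) * r ^ mdeg (fst (forest_total ss))"
  by (induction ss) (auto simp: forest_total_Nil forest_total_Cons mdeg_add power_add mdeg_eq_0_iff[THEN iffD2] mult_ac)

lemma nverts_le_forest_total: "s \<in> set ss \<Longrightarrow> snd (snd s) \<le> snd (forest_total ss)"
  by (induction ss) (auto simp: forest_total_Cons)

text \<open>The quantitative content of the assumptions: absolute convergence of the part subtracted
  in F at the point with all coordinates \<open>r0\<close>, and, from the series of powers of A, a
  bound for the partial sums of norms together with their decay.\<close>

locale tree_inversion =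
  fixes H :: "'n::finite \<Rightarrow> ('n \<Rightarrow> nat) \<Rightarrow> complex" and r0 C :: real
  assumes r0: "r0 > 0" and conv: "\<And>i. majorant 1 H i r0 summable_on UNIV"
    and C: "C > 0" and C_bound: "\<And>N. (\<Sum>k<N. entry_norm (mpow (linmat H) k)) \<le> C"
    and decay: "(\<lambda>k. entry_norm (mpow (linmat H) k)) \<longlonglongrightarrow> 0"
begin

definition K :: "nat \<Rightarrow> real" where
  "K d = (\<Sum>i\<in>UNIV. infsum (majorant d H i r0) UNIV)"

lemma conv_trunc: "d \<ge> 1 \<Longrightarrow> majorant d H i r0 summable_on UNIV"
  by (rule summable_on_comparison_test[OF conv[of i]])
     (use r0 in \<open>auto simp: majorant_def trunc_def\<close>)

lemma K_nonneg: "0 \<le> K d"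
  unfolding K_def by (intro sum_nonneg infsum_nonneg majorant_nonneg) (use r0 in auto)

lemma majorant_bound:
  assumes "0 \<le> x" "x \<le> r0" "d \<ge> 1"
  shows "majorant d H i x summable_on UNIV"
    and "infsum (majorant d H i x) UNIV \<le> (x / r0) ^ d * infsum (majorant d H i r0) UNIV"
  using infsum_cmult_bound[OF conv_trunc[OF assms(3)] majorant_nonneg majorant_le_scale] assms r0 by blast+

lemma sum_majorant_bound:
  assumes "0 \<le> x" "x \<le> r0" "d \<ge> 1"
  shows "(\<Sum>i\<in>UNIV. infsum (majorant d H i x) UNIV) \<le> (x / r0) ^ d * K d"
  unfolding K_def sum_distrib_left by (intro sum_mono majorant_bound assms)

definition sterm :: "real \<Rightarrow> 'n \<times> ('n \<Rightarrow> nat) \<times> nat \<Rightarrow> real" where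
  "sterm r s = cmod (class_weight H s) * r ^ mdeg (fst (snd s))"

text \<open>A finite index set outside which all weights with at most N vertices vanish. It makes
  \<open>psum\<close> a finite sum that still covers every leaf count.\<close>

definition leaf_idx :: "nat \<Rightarrow> ('n \<Rightarrow> nat) set" where
  "leaf_idx N = leafcnt ` {T :: 'n ttree. nverts T \<le> N}"

definition psum :: "real \<Rightarrow> nat \<Rightarrow> real" where
  "psum r N = (\<Sum>i\<in>UNIV. \<Sum>k\<in>leaf_idx N \<times> {..N}. sterm r (i, k))"

lemma finite_leaf_idx: "finite (leaf_idx N)"
  by (simp add: leaf_idx_def finite_nverts_le)

lemma sterm_nonneg: "0 \<le> r \<Longrightarrow> 0 \<le> sterm r s"
  by (simp add: sterm_def)

lemma sterm_eq_0:
  assumes "m \<le> N" "\<alpha> \<notin> leaf_idx N"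
  shows "sterm r (i, \<alpha>, m) = 0"
proof -
  have "(i, \<alpha>, m) \<notin> range tclass" using assms by (auto simp: tclass_def leaf_idx_def)
  then show ?thesis by (simp add: sterm_def class_weight_eq_0)
qed

lemma sterm_outside: "k \<notin> leaf_idx N \<times> {..N} \<Longrightarrow> snd k \<le> N \<Longrightarrow> sterm r (i, k) = 0"
  using sterm_eq_0[of "snd k" N "fst k"] by (cases k) auto

text \<open>A list with at most N vertices in total only involves classes with at most N vertices,
  whose weights, for each type, sum to at most \<open>psum r N\<close>. Different pairs (\<alpha>,
  m) use disjoint sets of lists, so everything is one finite sum of the kind controlled by
  \<open>forest_sum_bound\<close>.\<close>

lemma higher_terms_bound:
  assumes r: "0 < r" and le: "psum r N \<le> r0" and A: "finite A"
  shows "(\<Sum>\<alpha>\<in>A. \<Sum>m\<le>N. cmod (\<Sum>ss | ss \<in> forests \<alpha> m \<and> length ss \<ge> 2. forest_term H i ss) * r ^ mdeg \<alpha>)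
         \<le> infsum (majorant 2 H i (psum r N)) UNIV"
proof -
  \<comment> \<open>The cutoff at N gives \<open>f\<close> finite support for each type; it changes
    no entry of the lists that occur.\<close>
  define f where "f s = (if snd (snd s) \<le> N then sterm r s else 0)" for s
  define h where "h ss = cmod (trunc 2 H i (count_list (map fst ss))) / fact (length ss) * prod_list (map f ss)" for ss
  define Q where "Q = (\<lambda>(\<alpha>, m). {ss. ss \<in> forests \<alpha> m \<and> length ss \<ge> 2} :: ('n \<times> ('n \<Rightarrow> nat) \<times> nat) list set)"
  have Qfin: "finite (Q p)" for p
    unfolding Q_def by (auto simp: split_beta intro: finite_subset[OF _ finite_forests])
  have Qtot: "forest_total ss = p" if "ss \<in> Q p" for ss p
    using that by (auto simp: Q_def forests_def)
  have h: "cmod (forest_term H i ss) * r ^ mdeg \<alpha> = h ss" if "ss \<in> Q (\<alpha>, m)" "m \<le> N" for ss \<alpha> m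
  proof -
    have tot: "forest_total ss = (\<alpha>, m)" using Qtot that by blast
    have "f s = sterm r s" if "s \<in> set ss" for s
      using nverts_le_forest_total[OF that] tot \<open>m \<le> N\<close> by (simp add: f_def)
    then have "prod_list (map f ss) = prod_list (map (sterm r) ss)" by (metis (mono_tags, lifting) map_cong)
    also have "\<dots> = cmod (prod_list (map (class_weight H) ss)) * r ^ mdeg \<alpha>"
      unfolding sterm_def prod_list_mult_power_mdeg norm_prod_list tot by simp
    finally have p: "prod_list (map f ss) = cmod (prod_list (map (class_weight H) ss)) * r ^ mdeg \<alpha>" .
    have "mdeg (count_list (map fst ss)) \<ge> 2"
      using that(1) length_eq_mdeg_count[of "map fst ss"] by (simp add: Q_def)
    then show ?thesis by (simp add: h_def p forest_term_def norm_mult norm_divide trunc_def)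
  qed
  have "(\<Sum>\<alpha>\<in>A. \<Sum>m\<le>N. cmod (\<Sum>ss | ss \<in> forests \<alpha> m \<and> length ss \<ge> 2. forest_term H i ss) * r ^ mdeg \<alpha>)
      \<le> (\<Sum>\<alpha>\<in>A. \<Sum>m\<le>N. \<Sum>ss\<in>Q (\<alpha>, m). cmod (forest_term H i ss) * r ^ mdeg \<alpha>)"
    unfolding sum_distrib_right[symmetric] Q_def using r
    by (intro sum_mono mult_right_mono) (auto intro: norm_sum)
  also have "\<dots> = (\<Sum>\<alpha>\<in>A. \<Sum>m\<le>N. \<Sum>ss\<in>Q (\<alpha>, m). h ss)"
    by (intro sum.cong refl h) auto
  also have "\<dots> = (\<Sum>p\<in>A \<times> {..N}. sum h (Q p))"
    by (simp add: sum.cartesian_product split_beta)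
  also have "\<dots> = sum h (\<Union>p\<in>A \<times> {..N}. Q p)"
  proof (rule sum.UNION_disjoint[symmetric])
    show "\<forall>p\<in>A \<times> {..N}. \<forall>q\<in>A \<times> {..N}. p \<noteq> q \<longrightarrow> Q p \<inter> Q q = {}"
      by (metis Qtot disjoint_iff)
  qed (use A Qfin in auto)
  also have "\<dots> \<le> infsum (majorant 2 H i (psum r N)) UNIV"
    unfolding h_def
  proof (rule forest_sum_bound)
    show "0 \<le> f s" for s using r by (simp add: f_def sterm_nonneg)
    have fin: "finite (leaf_idx N \<times> {..N})" by (simp add: finite_leaf_idx)
    have fs: "((\<lambda>k. f (t, k)) has_sum (\<Sum>k\<in>leaf_idx N \<times> {..N}. sterm r (t, k))) UNIV" for t
    proof (rule has_sum_finite_neutralI[OF fin])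
      show "f (t, k) = 0" if "k \<in> UNIV - leaf_idx N \<times> {..N}" for k
        using that sterm_outside[of k N] by (simp add: f_def)
    qed (auto simp: f_def intro!: sum.cong)
    show "(\<lambda>k. f (t, k)) summable_on UNIV" for t using fs by (rule has_sum_imp_summable)
    have p0: "0 \<le> (\<Sum>k\<in>leaf_idx N \<times> {..N}. sterm r (t, k))" for t
      using r by (intro sum_nonneg sterm_nonneg) auto
    show "(\<Sum>\<^sub>\<infinity>k. f (t, k)) \<le> psum r N" for t
      unfolding infsumI[OF fs] psum_def
      by (rule member_le_sum[where f="\<lambda>t. \<Sum>k\<in>leaf_idx N \<times> {..N}. sterm r (t, k)"]) (use p0 in auto)
    have "0 \<le> psum r N" unfolding psum_def by (intro sum_nonneg p0)
    then show "majorant 2 H i (psum r N) summable_on UNIV" by (rule majorant_bound) (use le in auto)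
    show "finite (\<Union>p\<in>A \<times> {..N}. Q p)" using A Qfin by auto
  qed
  finally show ?thesis .
qed

text \<open>The vertices with one child contribute \<open>A\<close>; solving the resulting linear recurrence in the
  number of vertices costs the factor \<open>C\<close> and leaves only terms that are at least quadratic.\<close>

lemma psum_step:
  assumes r: "0 < r" and le: "psum r N \<le> r0"
  shows "psum r (Suc N) \<le> C * (real CARD('n) * r + (\<Sum>i\<in>UNIV. infsum (majorant 2 H i (psum r N)) UNIV))"
proof -
  let ?A = "leaf_idx (Suc N)"
  define v where "v \<alpha> m = (\<chi> i. class_weight H (i, \<alpha>, m))" for \<alpha> m
  define \<delta> where "\<delta> i \<alpha> m = (if m = (0::nat) \<and> \<alpha> = unitidx i then 1 else 0::complex)" for i :: 'n and \<alpha> m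
  define R where "R i \<alpha> m = (\<Sum>ss | ss \<in> forests \<alpha> m \<and> length ss \<ge> 2. forest_term H i ss)" for i \<alpha> m
  define e where "e \<alpha> m = (\<chi> i. \<delta> i \<alpha> m + R i \<alpha> m)" for \<alpha> m
  \<comment> \<open>The leaf counts stay fixed: only the root type and the number of vertices take
    part in the linear recurrence, so the matrix bound applies separately for each \<alpha>.\<close>
  have lin: "(\<Sum>m\<le>Suc N. l1_norm (v \<alpha> m)) \<le> C * (\<Sum>m\<le>N. l1_norm (e \<alpha> m))" for \<alpha>
  proof -
    have "v \<alpha> 0 = 0" by (simp add: v_def class_weight_0 vec_eq_iff)
    moreover have "v \<alpha> (Suc m) = linmat H *v v \<alpha> m + e \<alpha> m" for m
      unfolding v_def e_def \<delta>_def R_def class_weight_Suc_linear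
      by (simp add: vec_eq_iff matrix_vector_mult_def linmat_def)
    ultimately show ?thesis
      using linear_recurrence_bound[OF _ _ C_bound, of "v \<alpha>" "e \<alpha>" "Suc N"] by (simp only: lessThan_Suc_atMost)
  qed
  have "psum r (Suc N) = (\<Sum>i\<in>UNIV. \<Sum>\<alpha>\<in>?A. \<Sum>m\<le>Suc N. cmod (class_weight H (i, \<alpha>, m)) * r ^ mdeg \<alpha>)"
    unfolding psum_def sum.cartesian_product sterm_def by (auto intro!: sum.cong)
  also have "\<dots> = (\<Sum>\<alpha>\<in>?A. \<Sum>i\<in>UNIV. \<Sum>m\<le>Suc N. cmod (class_weight H (i, \<alpha>, m)) * r ^ mdeg \<alpha>)"
    by (rule sum.swap)
  also have "\<dots> = (\<Sum>\<alpha>\<in>?A. \<Sum>m\<le>Suc N. \<Sum>i\<in>UNIV. cmod (class_weight H (i, \<alpha>, m)) * r ^ mdeg \<alpha>)"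
    by (intro sum.cong refl sum.swap)
  also have "\<dots> = (\<Sum>\<alpha>\<in>?A. (\<Sum>m\<le>Suc N. l1_norm (v \<alpha> m)) * r ^ mdeg \<alpha>)"
    by (simp only: sum_distrib_right l1_norm_def v_def vec_lambda_beta)
  also have "\<dots> \<le> (\<Sum>\<alpha>\<in>?A. (C * (\<Sum>m\<le>N. l1_norm (e \<alpha> m))) * r ^ mdeg \<alpha>)"
    using r by (intro sum_mono mult_right_mono lin) auto
  also have "\<dots> = C * (\<Sum>\<alpha>\<in>?A. \<Sum>m\<le>N. l1_norm (e \<alpha> m) * r ^ mdeg \<alpha>)"
    by (simp add: sum_distrib_left sum_distrib_right mult_ac)
  also have "\<dots> \<le> C * (\<Sum>\<alpha>\<in>?A. \<Sum>m\<le>N. \<Sum>i\<in>UNIV. cmod (\<delta> i \<alpha> m) * r ^ mdeg \<alpha> + cmod (R i \<alpha> m) * r ^ mdeg \<alpha>)"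
    unfolding l1_norm_def e_def vec_lambda_beta sum_distrib_right distrib_right[symmetric] using r C
    by (intro mult_left_mono sum_mono mult_right_mono norm_triangle_ineq) auto
  also have "(\<Sum>\<alpha>\<in>?A. \<Sum>m\<le>N. \<Sum>i\<in>UNIV. cmod (\<delta> i \<alpha> m) * r ^ mdeg \<alpha> + cmod (R i \<alpha> m) * r ^ mdeg \<alpha>)
     = (\<Sum>\<alpha>\<in>?A. \<Sum>i\<in>UNIV. \<Sum>m\<le>N. cmod (\<delta> i \<alpha> m) * r ^ mdeg \<alpha> + cmod (R i \<alpha> m) * r ^ mdeg \<alpha>)"
    by (intro sum.cong refl sum.swap)
  also have "\<dots> = (\<Sum>i\<in>UNIV. \<Sum>\<alpha>\<in>?A. \<Sum>m\<le>N. cmod (\<delta> i \<alpha> m) * r ^ mdeg \<alpha> + cmod (R i \<alpha> m) * r ^ mdeg \<alpha>)"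
    by (rule sum.swap)
  also have "\<dots> = (\<Sum>i\<in>UNIV. \<Sum>\<alpha>\<in>?A. \<Sum>m\<le>N. cmod (\<delta> i \<alpha> m) * r ^ mdeg \<alpha>)
      + (\<Sum>i\<in>UNIV. \<Sum>\<alpha>\<in>?A. \<Sum>m\<le>N. cmod (R i \<alpha> m) * r ^ mdeg \<alpha>)"
    by (simp only: sum.distrib)
  also have "C * \<dots> \<le> C * (real CARD('n) * r + (\<Sum>i\<in>UNIV. infsum (majorant 2 H i (psum r N)) UNIV))"
  proof (intro mult_left_mono add_mono)
    \<comment> \<open>Only the one-vertex tree of type \<open>i\<close> enters here; it has one leaf
      and hence contributes r to the first power.\<close>
    have "(\<Sum>\<alpha>\<in>?A. \<Sum>m\<le>N. cmod (\<delta> i \<alpha> m) * r ^ mdeg \<alpha>) \<le> r" for i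
    proof -
      have "(\<Sum>m\<le>N. cmod (\<delta> i \<alpha> m) * r ^ mdeg \<alpha>) = (if \<alpha> = unitidx i then r else 0)" for \<alpha>
      proof -
        have "(\<Sum>m\<le>N. cmod (\<delta> i \<alpha> m) * r ^ mdeg \<alpha>) = (\<Sum>m\<le>N. if m = 0 then (if \<alpha> = unitidx i then r else 0) else 0)"
          by (rule sum.cong) (auto simp: \<delta>_def)
        then show ?thesis by simp
      qed
      then show ?thesis using r by (simp add: finite_leaf_idx)
    qed
    then have "(\<Sum>i\<in>UNIV. \<Sum>\<alpha>\<in>?A. \<Sum>m\<le>N. cmod (\<delta> i \<alpha> m) * r ^ mdeg \<alpha>) \<le> (\<Sum>i\<in>(UNIV::'n set). r)"
      by (rule sum_mono)
    then show "(\<Sum>i\<in>UNIV. \<Sum>\<alpha>\<in>?A. \<Sum>m\<le>N. cmod (\<delta> i \<alpha> m) * r ^ mdeg \<alpha>) \<le> real CARD('n) * r" by simp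
    show "(\<Sum>i\<in>UNIV. \<Sum>\<alpha>\<in>?A. \<Sum>m\<le>N. cmod (R i \<alpha> m) * r ^ mdeg \<alpha>) \<le> (\<Sum>i\<in>UNIV. infsum (majorant 2 H i (psum r N)) UNIV)"
      unfolding R_def by (intro sum_mono higher_terms_bound r le finite_leaf_idx)
  qed (use C in simp)
  finally show ?thesis .
qed

text \<open>\<open>D * r\<close> is the contribution of the one-vertex trees of all types after the
  factor \<open>C\<close> has been paid.\<close>

definition D :: real where "D = C * real CARD('n)"

text \<open>The first inequality keeps the bound 2 D r inside the region where the majorants
  converge. The second says that the quadratic term C * K 2 * (2 D r / r0)^2 is at most D r.\<close>

definition admissible :: "real \<Rightarrow> bool" where
  "admissible r \<longleftrightarrow> 0 < r \<and> 2 * D * r \<le> r0 \<and> 4 * C * K 2 * D * r \<le> r0 ^ 2"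

lemma D_pos: "D > 0"
  using C by (simp add: D_def)

text \<open>The bound reproduces itself: one half comes from the one-vertex trees and the other half
  pays for the quadratic term. The induction starts at 0 because there is no tree without
  vertices.\<close>

lemma psum_bound:
  assumes "admissible r"
  shows "psum r N \<le> 2 * D * r"
proof (induction N)
  case 0
  have "psum r 0 = 0" by (auto simp: psum_def sterm_def class_weight_0 intro!: sum.neutral)
  then show ?case using assms D_pos by (simp add: admissible_def)
next
  case (Suc N)
  have r: "0 < r" and 1: "2 * D * r \<le> r0" and 2: "4 * C * K 2 * D * r \<le> r0 ^ 2"
    using assms by (auto simp: admissible_def)
  have p0: "0 \<le> psum r N" unfolding psum_def using r by (intro sum_nonneg sterm_nonneg) auto
  have le: "psum r N \<le> r0" using Suc 1 by linarith
  have "psum r (Suc N) \<le> C * (real CARD('n) * r + (\<Sum>i\<in>UNIV. infsum (majorant 2 H i (psum r N)) UNIV))"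
    by (rule psum_step[OF r le])
  also have "\<dots> \<le> C * (real CARD('n) * r + (psum r N / r0) ^ 2 * K 2)"
    using C by (intro mult_left_mono add_left_mono sum_majorant_bound p0 le) auto
  also have "\<dots> \<le> C * (real CARD('n) * r + (2 * D * r / r0) ^ 2 * K 2)"
    using C Suc p0 r0 K_nonneg
    by (intro mult_left_mono add_left_mono mult_right_mono power_mono divide_right_mono) auto
  also have "\<dots> = D * r + (4 * C * K 2 * D * r) * (D * r) / r0 ^ 2"
    by (simp add: D_def power2_eq_square algebra_simps)
  also have "(4 * C * K 2 * D * r) * (D * r) / r0 ^ 2 \<le> r0 ^ 2 * (D * r) / r0 ^ 2"
    using 2 D_pos r by (intro divide_right_mono mult_right_mono) auto
  also have "D * r + r0 ^ 2 * (D * r) / r0 ^ 2 = 2 * D * r" using r0 by simp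
  finally show ?case by simp
qed

end

section \<open>The functional equation\<close>

text \<open>Every finite tree has a leaf; this gives the inverse series its vanishing constant
  term.\<close>

lemma leafcnt_neq_0: "leafcnt T \<noteq> (\<lambda>_. 0)"
proof (induction T)
  case (Node t cs)
  show ?case
  proof (cases cs)
    case Nil
    then have "leafcnt (Node t cs) t = 1" by simp
    then show ?thesis by (metis zero_neq_one)
  next
    case (Cons c cs')
    then obtain j where "leafcnt c j \<noteq> 0" using Node[of c] by (auto simp: fun_eq_iff)
    then have "leafcnt (Node t cs) j \<noteq> 0" using Cons by simp
    then show ?thesis by metis
  qed
qed

context tree_inversion
begin

text \<open>Any finite set of indices involves only vertex numbers up to some N, so the bound on
  \<open>psum\<close>, uniform in N, controls every finite partial sum.\<close>

lemma sterm_summable: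
  assumes "admissible r"
  shows "(\<lambda>k. sterm r (i, k)) summable_on UNIV" and "(\<Sum>\<^sub>\<infinity>k. sterm r (i, k)) \<le> 2 * D * r"
proof -
  have r: "0 < r" using assms by (simp add: admissible_def)
  have fin: "(\<Sum>k\<in>F. sterm r (i, k)) \<le> 2 * D * r" if F: "finite F" for F
  proof -
    obtain N where N: "\<And>k. k \<in> F \<Longrightarrow> snd k \<le> N"
      using finite_nat_set_iff_bounded_le[of "snd ` F"] F by auto
    have "(\<Sum>k\<in>F. sterm r (i, k)) = (\<Sum>k\<in>F \<inter> (leaf_idx N \<times> {..N}). sterm r (i, k))"
    proof (rule sum.mono_neutral_right)
      show "\<forall>k\<in>F - F \<inter> (leaf_idx N \<times> {..N}). sterm r (i, k) = 0"
        using N sterm_outside by blast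
    qed (use F in auto)
    also have "\<dots> \<le> (\<Sum>k\<in>leaf_idx N \<times> {..N}. sterm r (i, k))"
      by (rule sum_mono2) (use r in \<open>auto simp: finite_leaf_idx sterm_nonneg\<close>)
    also have "\<dots> \<le> psum r N"
      unfolding psum_def
      by (rule member_le_sum[where f="\<lambda>t. \<Sum>k\<in>leaf_idx N \<times> {..N}. sterm r (t, k)"])
         (use r in \<open>auto intro: sum_nonneg simp: sterm_nonneg\<close>)
    also have "\<dots> \<le> 2 * D * r" by (rule psum_bound[OF assms])
    finally show ?thesis .
  qed
  show s: "(\<lambda>k. sterm r (i, k)) summable_on UNIV"
    by (rule nonneg_bdd_above_summable_on) (use r fin in \<open>auto simp: sterm_nonneg intro!: bdd_aboveI\<close>)
  show "(\<Sum>\<^sub>\<infinity>k. sterm r (i, k)) \<le> 2 * D * r"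
    by (rule infsum_le_finite_sums[OF s]) (use fin in auto)
qed

definition tree_coeff :: "'n \<Rightarrow> ('n \<Rightarrow> nat) \<Rightarrow> complex" where
  "tree_coeff i \<alpha> = (\<Sum>\<^sub>\<infinity>m. class_weight H (i, \<alpha>, m))"

text \<open>The vertex number is kept as a summation index, since the functional equation shifts it
  by one. Summing it out recovers the power series with coefficients
  \<open>tree_coeff\<close>.\<close>

definition tree_series :: "('n \<Rightarrow> complex) \<Rightarrow> 'n \<Rightarrow> complex" where
  "tree_series z i = (\<Sum>\<^sub>\<infinity>k. class_weight H (i, k) * monom z (fst k))"

lemma tree_coeff_has_sum:
  assumes "admissible r"
  shows "((\<lambda>m. class_weight H (i, \<alpha>, m)) has_sum tree_coeff i \<alpha>) UNIV"
proof -
  have r: "0 < r" using assms by (simp add: admissible_def)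
  have "(\<lambda>(\<alpha>, m). sterm r (i, \<alpha>, m)) summable_on UNIV \<times> UNIV"
  proof -
    have "(\<lambda>(\<alpha>, m). sterm r (i, \<alpha>, m)) = (\<lambda>k. sterm r (i, k))" by auto
    then show ?thesis using sterm_summable(1)[OF assms, of i] by simp
  qed
  then have "(\<lambda>m. sterm r (i, \<alpha>, m)) summable_on UNIV" by (rule summable_on_SigmaD1) simp
  then have "(\<lambda>m. sterm r (i, \<alpha>, m) * (1 / r ^ mdeg \<alpha>)) summable_on UNIV" by (rule summable_on_cmult_left)
  then have "(\<lambda>m. norm (class_weight H (i, \<alpha>, m))) summable_on UNIV" using r by (simp add: sterm_def)
  then show ?thesis unfolding tree_coeff_def by (rule has_sum_infsum[OF abs_summable_summable])
qed

lemma gpartial_tendsto: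
  assumes "admissible r"
  shows "gpartial H i \<alpha> \<longlonglongrightarrow> tree_coeff i \<alpha>"
  using has_sum_imp_sums[OF tree_coeff_has_sum[OF assms]]
  unfolding gpartial_eq_sum[abs_def] sums_def_le .

lemma tree_coeff_0: "tree_coeff i (\<lambda>_. 0) = 0"
proof -
  have "class_weight H (i, \<lambda>_. 0, m) = 0" for m
  proof (rule class_weight_eq_0)
    have "(i, \<lambda>_. 0, m) \<noteq> tclass T" for T using leafcnt_neq_0[of T] by (auto simp: tclass_def)
    then show "(i, \<lambda>_. 0, m) \<notin> range tclass" by blast
  qed
  then show ?thesis by (simp add: tree_coeff_def)
qed

lemma norm_term_le_sterm:
  assumes "\<And>j. cmod (z j) \<le> r"
  shows "cmod (class_weight H (i, k) * monom z (fst k)) \<le> sterm r (i, k)"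
  unfolding sterm_def norm_mult by (auto intro!: mult_left_mono cmod_monom_le assms)

lemma
  assumes adm: "admissible r" and z: "\<And>j. cmod (z j) \<le> r"
  shows term_abs_summable: "(\<lambda>k. norm (class_weight H (i, k) * monom z (fst k))) summable_on UNIV"
    and infsum_norm_term_le: "(\<Sum>\<^sub>\<infinity>k. norm (class_weight H (i, k) * monom z (fst k))) \<le> 2 * D * r"
    and tree_series_has_sum: "((\<lambda>k. class_weight H (i, k) * monom z (fst k)) has_sum tree_series z i) UNIV"
    and tree_series_bound: "cmod (tree_series z i) \<le> 2 * D * r"
    and tree_coeff_series: "((\<lambda>\<alpha>. tree_coeff i \<alpha> * monom z \<alpha>) has_sum tree_series z i) UNIV"
proof -
  show s: "(\<lambda>k. norm (class_weight H (i, k) * monom z (fst k))) summable_on UNIV"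
    by (rule summable_on_comparison_test[OF sterm_summable(1)[OF adm, of i]])
       (use norm_term_le_sterm[OF z] in auto)
  show b: "(\<Sum>\<^sub>\<infinity>k. norm (class_weight H (i, k) * monom z (fst k))) \<le> 2 * D * r"
    using infsum_mono[OF s sterm_summable(1)[OF adm, of i] norm_term_le_sterm[OF z]]
      sterm_summable(2)[OF adm, of i] by simp
  show h: "((\<lambda>k. class_weight H (i, k) * monom z (fst k)) has_sum tree_series z i) UNIV"
    unfolding tree_series_def using s by (rule has_sum_infsum[OF abs_summable_summable])
  show "cmod (tree_series z i) \<le> 2 * D * r"
    using norm_infsum_bound[OF s] b unfolding tree_series_def by simp
  have "((\<lambda>k. class_weight H (i, k) * monom z (fst k)) has_sum tree_series z i) (Sigma UNIV (\<lambda>_. UNIV))"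
    using h by simp
  then show "((\<lambda>\<alpha>. tree_coeff i \<alpha> * monom z \<alpha>) has_sum tree_series z i) UNIV"
    by (rule has_sum_SigmaD) (use has_sum_cmult_left[OF tree_coeff_has_sum[OF adm]] in simp)
qed

text \<open>This is the series subtracted from the identity in F, so that F v = v -
  \<open>perturbation v\<close>.\<close>

definition perturbation :: "('n \<Rightarrow> complex) \<Rightarrow> 'n \<Rightarrow> complex" where
  "perturbation v i = (\<Sum>\<^sub>\<infinity>\<beta>. trunc 1 H i \<beta> / of_nat (mfact \<beta>) * monom v \<beta>)"

lemma norm_trunc_term_le:
  assumes "\<And>j. cmod (v j) \<le> x"
  shows "cmod (trunc d H i \<beta> / of_nat (mfact \<beta>) * monom v \<beta>) \<le> majorant d H i x \<beta>"
  unfolding majorant_def norm_mult norm_divide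
  by (auto intro!: divide_right_mono mult_left_mono cmod_monom_le assms)

lemma trunc_has_sum:
  assumes v: "\<And>j. cmod (v j) \<le> x" and "x \<le> r0" "d \<ge> 1"
  shows "(\<lambda>\<beta>. norm (trunc d H i \<beta> / of_nat (mfact \<beta>) * monom v \<beta>)) summable_on UNIV"
    and "((\<lambda>\<beta>. trunc d H i \<beta> / of_nat (mfact \<beta>) * monom v \<beta>) has_sum
           (\<Sum>\<^sub>\<infinity>\<beta>. trunc d H i \<beta> / of_nat (mfact \<beta>) * monom v \<beta>)) UNIV"
proof -
  have "0 \<le> x" using norm_ge_zero order_trans v by blast
  then show s: "(\<lambda>\<beta>. norm (trunc d H i \<beta> / of_nat (mfact \<beta>) * monom v \<beta>)) summable_on UNIV"
    by (intro summable_on_comparison_test[OF majorant_bound(1)[of x d i]])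
       (use assms norm_trunc_term_le[OF v] in auto)
  then show "((\<lambda>\<beta>. trunc d H i \<beta> / of_nat (mfact \<beta>) * monom v \<beta>) has_sum
           (\<Sum>\<^sub>\<infinity>\<beta>. trunc d H i \<beta> / of_nat (mfact \<beta>) * monom v \<beta>)) UNIV"
    by (rule has_sum_infsum[OF abs_summable_summable])
qed

lemma Fcoeff_has_sum:
  assumes "\<And>j. cmod (v j) \<le> r0"
  shows "((\<lambda>\<beta>. Fcoeff H i \<beta> * monom v \<beta>) has_sum (v i - perturbation v i)) UNIV"
proof -
  have "((\<lambda>\<beta>. (if \<beta> = unitidx i then 1 else 0) * monom v \<beta>) has_sum v i) UNIV"
    by (rule has_sum_finite_neutralI[of "{unitidx i}"]) auto
  from has_sum_add[OF this has_sum_uminusI[OF trunc_has_sum(2)[OF assms order_refl, of 1 i]]]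
  have "((\<lambda>\<beta>. (if \<beta> = unitidx i then 1 else 0) * monom v \<beta> + - (trunc 1 H i \<beta> / of_nat (mfact \<beta>) * monom v \<beta>))
     has_sum (v i - perturbation v i)) UNIV"
    by (simp add: perturbation_def)
  then show ?thesis
    by (rule has_sum_cong[THEN iffD1, rotated])
       (auto simp: Fcoeff_def trunc_def left_diff_distrib Suc_le_eq mdeg_eq_0_iff)
qed

text \<open>Expanding the perturbation at the tree series gives a sum over all nonempty lists of
  classes. Regrouped by total leaf counts and vertices, it consists of the weights of the trees with
  such children, with one extra vertex for the root; the only tree not obtained is the single leaf,
  which contributes \<open>z i\<close>.\<close>

lemma tree_series_fixpoint:
  assumes adm: "admissible r" and z: "\<And>j. cmod (z j) \<le> r"
  shows "tree_series z i = z i + perturbation (tree_series z) i"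
proof -
  define f where "f s = class_weight H s * monom z (fst (snd s))" for s
  define g where "g ss = trunc 1 H i (count_list (map fst ss)) / fact (length ss) * prod_list (map f ss)" for ss
  have r: "0 < r" and Dr: "2 * D * r \<le> r0" using adm by (auto simp: admissible_def)
  have fs: "(\<lambda>k. norm (f (t, k))) summable_on UNIV" for t
    using term_abs_summable[OF adm z] by (simp add: f_def)
  have fy: "(\<Sum>\<^sub>\<infinity>k. f (t, k)) = tree_series z t" for t by (simp add: f_def tree_series_def)
  have D0: "0 \<le> 2 * D * r" using r D_pos by simp
  have conv1: "(\<lambda>\<beta>. norm (trunc 1 H i \<beta>) / real (mfact \<beta>) * (\<Prod>j\<in>UNIV. (\<Sum>\<^sub>\<infinity>k. norm (f (j,k))) ^ \<beta> j)) summable_on UNIV"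
  proof (rule summable_on_comparison_test[OF majorant_bound(1)[OF D0 Dr order_refl]])
    fix \<beta> :: "'n \<Rightarrow> nat"
    have n: "0 \<le> (\<Sum>\<^sub>\<infinity>k. norm (f (j,k)))" for j by (rule infsum_nonneg) simp
    have "(\<Prod>j\<in>UNIV. (\<Sum>\<^sub>\<infinity>k. norm (f (j,k))) ^ \<beta> j) \<le> (\<Prod>j\<in>UNIV. (2 * D * r) ^ \<beta> j)"
      using infsum_norm_term_le[OF adm z] n
      by (intro prod_mono) (auto intro!: power_mono simp: f_def)
    then show "norm (trunc 1 H i \<beta>) / real (mfact \<beta>) * (\<Prod>j\<in>UNIV. (\<Sum>\<^sub>\<infinity>k. norm (f (j,k))) ^ \<beta> j) \<le> majorant 1 H i (2 * D * r) \<beta>"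
      unfolding majorant_def monom_const by (intro mult_left_mono) auto
    show "0 \<le> norm (trunc 1 H i \<beta>) / real (mfact \<beta>) * (\<Prod>j\<in>UNIV. (\<Sum>\<^sub>\<infinity>k. norm (f (j,k))) ^ \<beta> j)"
      by (intro mult_nonneg_nonneg divide_nonneg_nonneg prod_nonneg zero_le_power) (auto simp: n)
  qed
  have gs: "(\<lambda>ss. norm (g ss)) summable_on UNIV"
    unfolding g_def by (rule list_sums(1)[OF fs conv1])
  have "infsum g UNIV = perturbation (tree_series z) i"
    unfolding g_def perturbation_def using infsumI[OF list_sums(2)[OF fs conv1]] by (simp add: fy monom_def)
  then have g1: "(g has_sum perturbation (tree_series z) i) UNIV"
    using has_sum_infsum[OF abs_summable_summable[OF gs]] by simp
  \<comment> \<open>The empty list must not count, because a root without children is a leaf;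
    \<open>trunc 1\<close> removes exactly this term.\<close>
  have g_eq: "g ss = (if ss = [] then 0 else forest_term H i ss * monom z (fst (forest_total ss)))" for ss
  proof (cases "ss = []")
    case True
    then show ?thesis by (simp add: g_def trunc_def mdeg_def)
  next
    case False
    then have "mdeg (count_list (map fst ss)) \<ge> 1"
      using length_eq_mdeg_count[of "map fst ss"] by (cases ss) auto
    moreover have "prod_list (map f ss) = prod_list (map (class_weight H) ss) * monom z (fst (forest_total ss))"
      unfolding f_def by (rule prod_list_mult_monom)
    ultimately show ?thesis
      using False by (simp add: g_def forest_term_def trunc_def)
  qed
  have g2: "(g has_sum perturbation (tree_series z) i) {ss. ss \<noteq> []}"
    using g1 by (rule has_sum_cong_neutral[THEN iffD1, rotated -1]) (auto simp: g_eq)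
  define \<delta> where "\<delta> k = (if k = (unitidx i, 0::nat) then 1 else 0::complex)" for k
  have fib: "(g has_sum (class_weight H (i, fst k, Suc (snd k)) - \<delta> k) * monom z (fst k)) {ss \<in> {ss. ss \<noteq> []}. forest_total ss = k}" for k
  proof -
    have "((\<lambda>ss. forest_term H i ss * monom z (fst k)) has_sum (class_weight H (i, fst k, Suc (snd k)) - \<delta> k) * monom z (fst k))
       {ss \<in> {ss. ss \<noteq> []}. forest_total ss = k}"
      using has_sum_cmult_left[OF has_sum_forest_term[of H i "fst k" "snd k"]]
      by (cases k) (auto simp: \<delta>_def conj_commute)
    then show ?thesis
      by (rule has_sum_cong[THEN iffD1, rotated]) (auto simp: g_eq)
  qed
  have "((\<lambda>k. (class_weight H (i, fst k, Suc (snd k)) - \<delta> k) * monom z (fst k)) has_sum perturbation (tree_series z) i) UNIV"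
    by (rule has_sum_fibresD[OF g2 fib]) auto
  moreover have "((\<lambda>k. \<delta> k * monom z (fst k)) has_sum z i) UNIV"
    by (rule has_sum_finite_neutralI[of "{(unitidx i, 0)}"]) (auto simp: \<delta>_def)
  ultimately have "((\<lambda>k. (class_weight H (i, fst k, Suc (snd k)) - \<delta> k) * monom z (fst k) + \<delta> k * monom z (fst k))
      has_sum perturbation (tree_series z) i + z i) UNIV"
    by (rule has_sum_add)
  then have shifted: "((\<lambda>k. class_weight H (i, fst k, Suc (snd k)) * monom z (fst k)) has_sum perturbation (tree_series z) i + z i) UNIV"
    by (simp add: left_diff_distrib)
  \<comment> \<open>The shift accounts for the root as an additional vertex. It misses only vertex
    number 0, where all weights vanish.\<close>
  define \<sigma> where "\<sigma> k = (fst k, Suc (snd k))" for k :: "('n \<Rightarrow> nat) \<times> nat"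
  have "inj \<sigma>" by (auto simp: \<sigma>_def inj_on_def prod_eq_iff)
  then have "((\<lambda>k. class_weight H (i, k) * monom z (fst k)) has_sum perturbation (tree_series z) i + z i) (range \<sigma>)"
    using shifted by (subst has_sum_reindex) (auto simp: \<sigma>_def o_def)
  then have "((\<lambda>k. class_weight H (i, k) * monom z (fst k)) has_sum perturbation (tree_series z) i + z i) UNIV"
  proof (rule has_sum_cong_neutral[THEN iffD1, rotated -1])
    fix k assume "k \<in> UNIV - range \<sigma>"
    then have "snd k = 0" by (cases "snd k") (auto simp: \<sigma>_def image_iff prod_eq_iff)
    then show "class_weight H (i, k) * monom z (fst k) = 0"
      using class_weight_0[of H i "fst k"] by (cases k) simp
  qed auto
  then show ?thesis
    using has_sum_unique[OF tree_series_has_sum[OF adm z, of i]] by (simp add: add.commute)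
qed

section \<open>Injectivity of F near 0\<close>

lemma perturbation_split:
  assumes "\<And>j. cmod (v j) \<le> r0"
  shows "perturbation v i = (\<Sum>j\<in>UNIV. H i (unitidx j) * v j) + (\<Sum>\<^sub>\<infinity>\<beta>. trunc 2 H i \<beta> / of_nat (mfact \<beta>) * monom v \<beta>)"
proof -
  have "((\<lambda>\<beta>. if mdeg \<beta> = 1 then H i \<beta> / of_nat (mfact \<beta>) * monom v \<beta> else 0) has_sum (\<Sum>j\<in>UNIV. H i (unitidx j) * v j)) UNIV"
  proof (rule has_sum_finite_neutralI[of "range unitidx"])
    have "inj (unitidx :: 'n \<Rightarrow> _)" by (auto simp: inj_on_def unitidx_def fun_eq_iff split: if_splits)
    then show "(\<Sum>j\<in>UNIV. H i (unitidx j) * v j) = (\<Sum>\<beta>\<in>range unitidx. if mdeg \<beta> = 1 then H i \<beta> / of_nat (mfact \<beta>) * monom v \<beta> else 0)"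
      by (subst sum.reindex) auto
  qed (use mdeg_eq_1D in auto)
  from has_sum_add[OF this trunc_has_sum(2)[OF assms order_refl, of 2 i]]
  have "((\<lambda>\<beta>. (if mdeg \<beta> = 1 then H i \<beta> / of_nat (mfact \<beta>) * monom v \<beta> else 0) + trunc 2 H i \<beta> / of_nat (mfact \<beta>) * monom v \<beta>) has_sum
     (\<Sum>j\<in>UNIV. H i (unitidx j) * v j) + (\<Sum>\<^sub>\<infinity>\<beta>. trunc 2 H i \<beta> / of_nat (mfact \<beta>) * monom v \<beta>)) UNIV" by simp
  then have "((\<lambda>\<beta>. trunc 1 H i \<beta> / of_nat (mfact \<beta>) * monom v \<beta>) has_sum
     (\<Sum>j\<in>UNIV. H i (unitidx j) * v j) + (\<Sum>\<^sub>\<infinity>\<beta>. trunc 2 H i \<beta> / of_nat (mfact \<beta>) * monom v \<beta>)) UNIV"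
    by (rule has_sum_cong[THEN iffD1, rotated]) (auto simp: trunc_def)
  then show ?thesis unfolding perturbation_def by (rule infsumI)
qed

text \<open>Differences of monomials of degree n + 2 cost a factor (n + 2) \<rho> ^ (n + 1). Since
  \<rho> is at most half of \<open>r0\<close>, the gain 2 ^ (-n) absorbs n + 2 up to the constant 2,
  and one factor \<rho> remains to make the Lipschitz constant small.\<close>

lemma higher_part_lipschitz:
  assumes v: "\<And>j. cmod (v j) \<le> \<rho>" and w: "\<And>j. cmod (w j) \<le> \<rho>" and d: "\<And>j. cmod (v j - w j) \<le> X"
    and \<rho>: "0 < \<rho>" "2 * \<rho> \<le> r0" and X: "0 \<le> X"
  shows "cmod ((\<Sum>\<^sub>\<infinity>\<beta>. trunc 2 H i \<beta> / of_nat (mfact \<beta>) * monom v \<beta>) - (\<Sum>\<^sub>\<infinity>\<beta>. trunc 2 H i \<beta> / of_nat (mfact \<beta>) * monom w \<beta>))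
     \<le> 2 * \<rho> / r0 ^ 2 * X * infsum (majorant 2 H i r0) UNIV"
proof -
  have \<rho>r: "\<rho> \<le> r0" using \<rho> by simp
  define t where "t = (\<lambda>v \<beta>. trunc 2 H i \<beta> / of_nat (mfact \<beta>) * monom v \<beta>)"
  have hs: "((\<lambda>\<beta>. t v \<beta> + - t w \<beta>) has_sum infsum (t v) UNIV + - infsum (t w) UNIV) UNIV"
    unfolding t_def
    by (rule has_sum_add[OF trunc_has_sum(2)[OF v \<rho>r] has_sum_uminusI[OF trunc_has_sum(2)[OF w \<rho>r]]]) auto
  have le: "norm (t v \<beta> + - t w \<beta>) \<le> (2 * \<rho> / r0 ^ 2 * X) * majorant 2 H i r0 \<beta>" for \<beta>
  proof (cases "mdeg \<beta> \<ge> 2")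
    case True
    then obtain n where n: "mdeg \<beta> = n + 2" by (metis add.commute le_Suc_ex)
    have n2: "real (n + 2) / 2 ^ n \<le> 2"
    proof -
      have "n + 2 \<le> 2 * 2 ^ n" by (induction n) auto
      then have "real (n + 2) \<le> real (2 * 2 ^ n)" by (simp only: of_nat_le_iff)
      then show ?thesis by (simp add: divide_le_eq)
    qed
    have "real (n + 2) * \<rho> ^ (n + 1) = \<rho> * (real (n + 2) * \<rho> ^ n)" by simp
    also have "\<dots> \<le> \<rho> * (real (n + 2) * (r0 / 2) ^ n)"
      using \<rho> by (intro mult_left_mono power_mono) auto
    also have "\<dots> = \<rho> * (real (n + 2) / 2 ^ n * r0 ^ n)" by (simp add: power_divide)
    also have "\<dots> \<le> \<rho> * (2 * r0 ^ n)"
      using \<rho> r0 n2 by (intro mult_left_mono mult_right_mono) auto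
    also have "\<dots> = 2 * \<rho> / r0 ^ 2 * r0 ^ (n + 2)" using r0 by (simp add: power2_eq_square)
    finally have k: "real (mdeg \<beta>) * \<rho> ^ (mdeg \<beta> - 1) \<le> 2 * \<rho> / r0 ^ 2 * r0 ^ mdeg \<beta>" by (simp add: n)
    have "t v \<beta> + - t w \<beta> = trunc 2 H i \<beta> / of_nat (mfact \<beta>) * (monom v \<beta> - monom w \<beta>)"
      by (simp add: t_def right_diff_distrib diff_divide_distrib)
    then have "norm (t v \<beta> + - t w \<beta>) = cmod (trunc 2 H i \<beta>) / real (mfact \<beta>) * cmod (monom v \<beta> - monom w \<beta>)"
      by (simp only: norm_mult norm_divide norm_of_nat)
    also have "\<dots> \<le> cmod (trunc 2 H i \<beta>) / real (mfact \<beta>) * (real (mdeg \<beta>) * \<rho> ^ (mdeg \<beta> - 1) * X)"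
      by (intro mult_left_mono monom_diff_bound v w d) (use \<rho> X in auto)
    also have "\<dots> \<le> cmod (trunc 2 H i \<beta>) / real (mfact \<beta>) * (2 * \<rho> / r0 ^ 2 * r0 ^ mdeg \<beta> * X)"
      by (intro mult_left_mono mult_right_mono k X) auto
    finally show ?thesis by (simp add: majorant_def mult_ac)
  qed (simp add: t_def trunc_def majorant_def)
  have "norm (infsum (t v) UNIV + - infsum (t w) UNIV) \<le> (2 * \<rho> / r0 ^ 2 * X) * infsum (majorant 2 H i r0) UNIV"
    by (rule norm_infsum_le[OF hs has_sum_cmult_right[OF has_sum_infsum[OF conv_trunc]] le]) simp
  then show ?thesis by (simp add: t_def)
qed

text \<open>Two points with the same image under \<open>F\<close> differ by some \<open>x = A x + q\<close> with
  \<open>|q| \<le> |x| / (2 C)\<close>, whereas \<open>|x| \<le> C |q|\<close>.\<close>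

lemma injective_near_0:
  assumes v: "\<And>j. cmod (v j) \<le> \<rho>" and w: "\<And>j. cmod (w j) \<le> \<rho>"
    and \<rho>: "0 < \<rho>" "2 * \<rho> \<le> r0" and small: "4 * C * K 2 * \<rho> \<le> r0 ^ 2"
    and eq: "\<And>i. v i - perturbation v i = w i - perturbation w i"
  shows "v = w"
proof -
  have vr: "cmod (v j) \<le> r0" and wr: "cmod (w j) \<le> r0" for j using v[of j] w[of j] \<rho> by linarith+
  define x where "x = (\<chi> i. v i - w i)"
  define Q where "Q v i = (\<Sum>\<^sub>\<infinity>\<beta>. trunc 2 H i \<beta> / of_nat (mfact \<beta>) * monom v \<beta>)" for v i
  define q where "q = (\<chi> i. Q v i - Q w i)"
  have "x = linmat H *v x + q"
  proof -
    have *: "v i - w i = (\<Sum>j\<in>UNIV. H i (unitidx j) * (v j - w j)) + (Q v i - Q w i)" for i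
    proof -
      have "v i - w i = perturbation v i - perturbation w i" using eq[of i] by (simp add: algebra_simps)
      then show ?thesis
        unfolding perturbation_split[OF vr] perturbation_split[OF wr] Q_def[symmetric]
        by (simp add: right_diff_distrib sum_subtractf)
    qed
    have "(linmat H *v x + q) $ i = x $ i" for i
      by (simp only: x_def q_def matrix_vector_mult_def linmat_def vec_lambda_beta vector_add_component *[symmetric])
    then show ?thesis by (simp add: vec_eq_iff)
  qed
  then have 1: "l1_norm x \<le> C * l1_norm q" by (rule linear_fixpoint_bound[OF _ C_bound decay])
  have d: "cmod (v j - w j) \<le> l1_norm x" for j
    unfolding l1_norm_def x_def using member_le_sum[of j UNIV "\<lambda>i. cmod (v i - w i)"] by simp
  have "l1_norm q = (\<Sum>i\<in>UNIV. cmod (Q v i - Q w i))" by (simp add: l1_norm_def q_def)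
  also have "\<dots> \<le> (\<Sum>i\<in>UNIV. 2 * \<rho> / r0 ^ 2 * l1_norm x * infsum (majorant 2 H i r0) UNIV)"
    unfolding Q_def
    by (intro sum_mono higher_part_lipschitz v w d \<rho> l1_norm_nonneg)
  also have "\<dots> = 2 * \<rho> / r0 ^ 2 * l1_norm x * K 2" by (simp add: K_def sum_distrib_left)
  finally have "C * l1_norm q \<le> C * (2 * \<rho> / r0 ^ 2 * l1_norm x * K 2)" using C by (intro mult_left_mono) auto
  also have "\<dots> = (4 * C * K 2 * \<rho>) / r0 ^ 2 * (l1_norm x / 2)" by simp
  also have "\<dots> \<le> 1 * (l1_norm x / 2)"
    using small r0 by (intro mult_right_mono) (auto simp: l1_norm_nonneg)
  finally have "l1_norm x \<le> 0" using 1 by simp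
  then have "cmod (v j - w j) \<le> 0" for j using d[of j] by linarith
  then show ?thesis by (auto simp: fun_eq_iff)
qed

text \<open>Guarantees that F maps a small polydisc into the one where the tree series converges, as
  is needed before forming G (F w).\<close>

lemma perturbation_bound:
  assumes "\<And>j. cmod (w j) \<le> s" "0 \<le> s" "s \<le> r0"
  shows "cmod (perturbation w i) \<le> s / r0 * K 1"
proof -
  have "cmod (perturbation w i) \<le> infsum (majorant 1 H i s) UNIV"
    unfolding perturbation_def
    by (rule norm_infsum_le[OF trunc_has_sum(2)[OF assms(1,3)] has_sum_infsum[OF majorant_bound(1)] norm_trunc_term_le])
       (use assms in auto)
  also have "\<dots> \<le> (s / r0) ^ 1 * infsum (majorant 1 H i r0) UNIV"
    by (rule majorant_bound(2)) (use assms in auto)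
  also have "\<dots> \<le> (s / r0) ^ 1 * K 1"
    unfolding K_def
    by (intro mult_left_mono member_le_sum[where f="\<lambda>i. infsum (majorant 1 H i r0) UNIV"] infsum_nonneg majorant_nonneg)
       (use assms r0 in auto)
  finally show ?thesis by simp
qed

end

section \<open>Local inversion\<close>

context tree_inversion
begin

lemma map_eval_F:
  assumes "\<And>j. cmod (v j) \<le> r0"
  shows "ps_conv (Fcoeff H i) v" and "map_eval (Fcoeff H) v = (\<lambda>i. v i - perturbation v i)"
  using Fcoeff_has_sum[of v, OF assms]
  by (auto simp: ps_conv_def map_eval_def ps_eval_def fun_eq_iff infsumI intro: has_sum_imp_summable)

lemma map_eval_tree_coeff:
  assumes "admissible r" "\<And>j. cmod (z j) \<le> r"
  shows "ps_conv (tree_coeff i) z" and "map_eval tree_coeff z = tree_series z"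
  using tree_coeff_series[of r z, OF assms]
  by (auto simp: ps_conv_def map_eval_def ps_eval_def fun_eq_iff infsumI intro: has_sum_imp_summable)

lemma inversion:
  "(\<forall>i \<alpha>. gpartial H i \<alpha> \<longlonglongrightarrow> tree_coeff i \<alpha>) \<and>
   (\<exists>r>0. map_conv_on tree_coeff r \<and>
      (\<forall>z. (\<forall>j. cmod (z j) < r) \<longrightarrow>
         (\<forall>i. ps_conv (Fcoeff H i) (map_eval tree_coeff z)) \<and>
         map_eval (Fcoeff H) (map_eval tree_coeff z) = z)) \<and>
   (\<exists>s>0. map_conv_on (Fcoeff H) s \<and>
      (\<forall>w. (\<forall>j. cmod (w j) < s) \<longrightarrow>
         (\<forall>i. ps_conv (tree_coeff i) (map_eval (Fcoeff H) w)) \<and>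
         map_eval tree_coeff (map_eval (Fcoeff H) w) = w))"
proof -
  have K2: "0 \<le> 4 * C * K 2" using C K_nonneg by simp
  \<comment> \<open>The radius on which F is injective; adding 1 keeps the denominator positive even
    if \<open>K 2\<close> is 0.\<close>
  define \<rho> where "\<rho> = min (r0 / 2) (r0 ^ 2 / (4 * C * K 2 + 1))"
  have \<rho>: "0 < \<rho>" "2 * \<rho> \<le> r0" using r0 K2 by (auto simp: \<rho>_def)
  have small: "4 * C * K 2 * \<rho> \<le> r0 ^ 2"
  proof -
    have "4 * C * K 2 * \<rho> \<le> (4 * C * K 2 + 1) * \<rho>" using \<rho> by (simp add: distrib_right)
    also have "\<dots> \<le> (4 * C * K 2 + 1) * (r0 ^ 2 / (4 * C * K 2 + 1))"
      using K2 by (intro mult_left_mono) (auto simp: \<rho>_def)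
    finally show ?thesis using K2 by simp
  qed
  \<comment> \<open>With this r the bound 2 D r for the values of the tree series is exactly \<rho>,
    so these values lie where F is injective.\<close>
  define r where "r = \<rho> / (2 * D)"
  have r: "0 < r" and Dr: "2 * D * r = \<rho>" using \<rho> D_pos by (auto simp: r_def)
  have "4 * C * K 2 * D * r = 4 * C * K 2 * \<rho> / 2" using Dr[symmetric] by simp
  also have "\<dots> \<le> r0 ^ 2" using small mult_nonneg_nonneg[OF K2 less_imp_le[OF \<rho>(1)]] by linarith
  finally have adm: "admissible r" using r Dr \<rho> by (simp add: admissible_def)
  have series_small: "cmod (tree_series z j) \<le> \<rho>" if "\<And>j. cmod (z j) \<le> r" for z j
    using tree_series_bound[of r z, OF adm that] Dr by simp
  then have series_small': "cmod (tree_series z j) \<le> r0" if "\<And>j. cmod (z j) \<le> r" for z j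
    using that \<rho> by (smt (verit))
  have FG: "map_eval (Fcoeff H) (tree_series z) = z" if z: "\<And>j. cmod (z j) \<le> r" for z
  proof
    fix i
    show "map_eval (Fcoeff H) (tree_series z) i = z i"
      unfolding map_eval_F(2)[of "tree_series z", OF series_small'[of z, OF z]] using tree_series_fixpoint[of r z i, OF adm z] by simp
  qed
  \<comment> \<open>On the polydisc of radius s the values of F are at most s + (s / r0) * K 1,
    which must not exceed r.\<close>
  define s where "s = min \<rho> (r / (1 + K 1 / r0))"
  have k1: "1 + K 1 / r0 > 0" using K_nonneg[of 1] r0 by (simp add: add_pos_nonneg)
  have s: "0 < s" "s \<le> \<rho>" "s \<le> r0" using \<rho> r k1 by (auto simp: s_def min_le_iff_disj)
  have s1: "s * (1 + K 1 / r0) \<le> r"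
  proof -
    have "s \<le> r / (1 + K 1 / r0)" by (simp add: s_def)
    then show ?thesis using k1 by (simp only: pos_le_divide_eq)
  qed
  have F_small: "cmod (map_eval (Fcoeff H) w i) \<le> r" if w: "\<And>j. cmod (w j) < s" for w i
  proof -
    have ws: "cmod (w j) \<le> s" and wr: "cmod (w j) \<le> r0" for j using w[of j] s by auto
    have "cmod (w i - perturbation w i) \<le> s + s / r0 * K 1"
      using s by (intro order_trans[OF norm_triangle_ineq4] add_mono ws perturbation_bound) auto
    also have "\<dots> = s * (1 + K 1 / r0)" by (simp add: distrib_left)
    finally show ?thesis using s1 map_eval_F(2)[of w, OF wr] by simp
  qed
  have GF: "tree_series (map_eval (Fcoeff H) w) = w" if w: "\<And>j. cmod (w j) < s" for w
  proof -
    let ?z = "map_eval (Fcoeff H) w"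
    have z: "cmod (?z j) \<le> r" for j by (rule F_small[of w, OF w])
    have wr: "cmod (w j) \<le> r0" for j using w[of j] s by auto
    have wrho: "cmod (w j) \<le> \<rho>" for j using w[of j] s by auto
    \<comment> \<open>Both \<open>tree_series ?z\<close> and \<open>w\<close> are preimages of
      \<open>?z\<close> under F within radius \<rho>.\<close>
    have "tree_series ?z i - perturbation (tree_series ?z) i = w i - perturbation w i" for i
      using tree_series_fixpoint[of r ?z i, OF adm z] fun_cong[OF map_eval_F(2)[of w, OF wr], of i] by simp
    then show ?thesis by (rule injective_near_0[OF series_small[of ?z, OF z] wrho \<rho> small])
  qed
  show ?thesis
  proof (intro conjI)
    show "\<forall>i \<alpha>. gpartial H i \<alpha> \<longlonglongrightarrow> tree_coeff i \<alpha>" using gpartial_tendsto[OF adm] by blast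
    have "ps_conv (tree_coeff i) z \<and> ps_conv (Fcoeff H i) (map_eval tree_coeff z) \<and>
         map_eval (Fcoeff H) (map_eval tree_coeff z) = z" if "\<forall>j. cmod (z j) < r" for z i
    proof -
      have z: "cmod (z j) \<le> r" for j using that by (simp add: less_imp_le)
      show ?thesis
        using map_eval_tree_coeff[of r z, OF adm z] map_eval_F(1)[of "tree_series z", OF series_small'[of z, OF z]] FG[of z, OF z] by simp
    qed
    then show "\<exists>r>0. map_conv_on tree_coeff r \<and>
      (\<forall>z. (\<forall>j. cmod (z j) < r) \<longrightarrow>
         (\<forall>i. ps_conv (Fcoeff H i) (map_eval tree_coeff z)) \<and>
         map_eval (Fcoeff H) (map_eval tree_coeff z) = z)"
      using r unfolding map_conv_on_def by blast
    have "ps_conv (Fcoeff H i) w \<and> ps_conv (tree_coeff i) (map_eval (Fcoeff H) w) \<and>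
         map_eval tree_coeff (map_eval (Fcoeff H) w) = w" if "\<forall>j. cmod (w j) < s" for w i
    proof -
      have w: "cmod (w j) < s" for j using that by simp
      have wr: "cmod (w j) \<le> r0" for j using w[of j] s by auto
      show ?thesis
        using map_eval_F(1)[of w, OF wr] map_eval_tree_coeff[of r "map_eval (Fcoeff H) w", OF adm F_small[of w, OF w]] GF[of w, OF w] by simp
    qed
    then show "\<exists>s>0. map_conv_on (Fcoeff H) s \<and>
      (\<forall>w. (\<forall>j. cmod (w j) < s) \<longrightarrow>
         (\<forall>i. ps_conv (tree_coeff i) (map_eval (Fcoeff H) w)) \<and>
         map_eval tree_coeff (map_eval (Fcoeff H) w) = w)"
      using s unfolding map_conv_on_def by blast
  qed
qed

end

text \<open>Convergence at the point with all coordinates x is unconditional, hence absolute for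
  complex terms. The coefficients of F and of the perturbation differ, up to sign, only by the
  identity term at \<open>unitidx i\<close>, which adds a single summand x to the dominating
  series.\<close>

lemma majorant_summable_of_map_conv_on:
  assumes "map_conv_on (Fcoeff H) r" "0 < x" "x < r"
  shows "majorant 1 H i x summable_on UNIV"
proof -
  have m: "monom (\<lambda>_. complex_of_real x) \<beta> = of_real (x ^ mdeg \<beta>)" for \<beta> :: "'a \<Rightarrow> nat"
    by (simp add: monom_def monom_const)
  have "ps_conv (Fcoeff H i) (\<lambda>_. of_real x)"
    using assms unfolding map_conv_on_def by auto
  then have "(\<lambda>\<beta>. cmod (Fcoeff H i \<beta> * monom (\<lambda>_. of_real x) \<beta>)) summable_on UNIV"
    unfolding ps_conv_def by (rule summable_on_iff_abs_summable_on_complex[THEN iffD1])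
  then have s1: "(\<lambda>\<beta>. cmod (Fcoeff H i \<beta>) * x ^ mdeg \<beta>) summable_on UNIV"
    using assms(2) by (simp add: m norm_mult norm_power del: of_real_power)
  have "((\<lambda>\<beta>. (if \<beta> = unitidx i then 1 else 0) * x ^ mdeg \<beta>) has_sum x) UNIV"
    by (rule has_sum_finite_neutralI[of "{unitidx i}"]) auto
  then have s2: "(\<lambda>\<beta>. (if \<beta> = unitidx i then 1 else 0) * x ^ mdeg \<beta>) summable_on UNIV"
    by (rule has_sum_imp_summable)
  show ?thesis
  proof (rule summable_on_comparison_test[OF summable_on_add[OF s2 s1]])
    fix \<beta>
    show "0 \<le> majorant 1 H i x \<beta>" using assms by (simp add: majorant_nonneg)
    have "trunc 1 H i \<beta> / of_nat (mfact \<beta>) = (if \<beta> = unitidx i then 1 else 0) - Fcoeff H i \<beta>"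
      by (auto simp: Fcoeff_def trunc_def Suc_le_eq mdeg_eq_0_iff)
    then have "cmod (trunc 1 H i \<beta> / of_nat (mfact \<beta>)) \<le> cmod (if \<beta> = unitidx i then 1 else 0) + cmod (Fcoeff H i \<beta>)"
      by (metis norm_triangle_ineq4)
    then have "cmod (trunc 1 H i \<beta>) / real (mfact \<beta>) \<le> (if \<beta> = unitidx i then 1 else 0) + cmod (Fcoeff H i \<beta>)"
      by (auto simp: norm_divide split: if_splits)
    then show "majorant 1 H i x \<beta> \<le> (if \<beta> = unitidx i then 1 else 0) * x ^ mdeg \<beta> + cmod (Fcoeff H i \<beta>) * x ^ mdeg \<beta>"
      unfolding majorant_def distrib_right[symmetric] using assms by (intro mult_right_mono) auto
  qed
qed

theorem theorem2p3:
  fixes H :: "'n::finite \<Rightarrow> ('n \<Rightarrow> nat) \<Rightarrow> complex"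
  assumes Fconv: "\<exists>r>0. map_conv_on (Fcoeff H) r"
    and Aconv: "summable (\<lambda>k. mpow (linmat H) k)"
  shows "\<exists>g :: 'n \<Rightarrow> ('n \<Rightarrow> nat) \<Rightarrow> complex.
           (\<forall>i \<alpha>. \<alpha> \<noteq> (\<lambda>_. 0) \<longrightarrow> gpartial H i \<alpha> \<longlonglongrightarrow> g i \<alpha>) \<and>
           (let G = (\<lambda>i \<alpha>. if \<alpha> = (\<lambda>_. 0) then 0 else g i \<alpha>) in
              (\<exists>r>0. map_conv_on G r \<and>
                 (\<forall>z. (\<forall>j. cmod (z j) < r) \<longrightarrow>
                    (\<forall>i. ps_conv (Fcoeff H i) (map_eval G z)) \<and>
                    map_eval (Fcoeff H) (map_eval G z) = z)) \<and>
              (\<exists>s>0. map_conv_on (Fcoeff H) s \<and>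
                 (\<forall>w. (\<forall>j. cmod (w j) < s) \<longrightarrow>
                    (\<forall>i. ps_conv (G i) (map_eval (Fcoeff H) w)) \<and>
                    map_eval G (map_eval (Fcoeff H) w) = w)))"
proof -
  obtain r where r: "r > 0" "map_conv_on (Fcoeff H) r" using Fconv by blast
  obtain C where C: "C > 0" "\<And>N. (\<Sum>k<N. entry_norm (mpow (linmat H) k)) \<le> C"
    using entry_norm_mpow_sum_bounded[OF Aconv] by blast
  \<comment> \<open>Convergence is assumed only strictly inside radius r, so the majorant is
    evaluated at half of it.\<close>
  interpret tree_inversion H "r / 2" C
    by standard
      (use r C entry_norm_mpow_tendsto_0[OF Aconv] majorant_summable_of_map_conv_on[OF r(2), of "r / 2"] in auto)
  \<comment> \<open>The default value 0 at the zero multi-index agrees with the tree sum, since no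
    tree is without leaves.\<close>
  have G: "(\<lambda>i \<alpha>. if \<alpha> = (\<lambda>_. 0) then 0 else tree_coeff i \<alpha>) = tree_coeff"
    by (auto simp: fun_eq_iff[of _ tree_coeff] tree_coeff_0)
  show ?thesis
    by (rule exI[of _ tree_coeff]) (use inversion in \<open>simp add: G Let_def\<close>)
qed

end
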